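(* Setting: $n$ agents on a connected, undirected weighted graph $\mathcal G$ with symmetric adjacency weights $a_{i,j}$ ($a_{i,j}>0$ iff $\{i,j\}$ is an edge, else $0$) and Laplacian $L_n$; $L=L_n\otimes I_m$. For each $i$, $\Omega_i\subset\mathbb R^{q_i}$ is closed and convex, $f^i$ is strictly convex on an open set containing $\Omega_i$, $W_i\in\mathbb R^{m\times q_i}$, $d_i\in\mathbb R^m$ with $\sum_id_i=d_0$; $\Omega=\prod_i\Omega_i$, $f(x)=\sum_if^i(x_i)$, $W=[W_1,\dots,W_n]$, $\overline W=\mathrm{diag}\{W_1,\dots,W_n\}$, $d=[d_1^{\rm T},\dots,d_n^{\rm T}]^{\rm T}$; Slater's condition holds (some $x$ in the interior of $\Omega$ has $Wx=d_0$). Consider the problem $\min f(x)$ s.t. $Wx=d_0$, $x\in\Omega$, and the algorithm (for $t\ge0$, $x_i(0)\in\Omega_i$, $\lambda_i(0),z_i(0)\in\mathbb R^m$ arbitrary) $$\dot x_i\in\{P_{\Omega_i}[x_i-g_i+W_i^{\rm T}\lambda_i]-x_i:\ g_i\in\partial f^i(x_i)\},$$ $$\dot\lambda_i=d_i-W_ix_i-\sum_ja_{i,j}(\lambda_i-\lambda_j)-\sum_ja_{i,j}(z_i-z_j)-W_i\dot x_i,\qquad \dot z_i=\sum_ja_{i,j}(\lambda_i-\lambda_j),$$ equivalently $(\dot x,\dot\lambda,\dot z)\in\mathcal F(x,\lambda,z)=\{(p,\ d-\overline Wx-L\lambda-Lz-\overline Wp,\ L\lambda):\ p=P_\Omega[x-g+\overline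 W^{\rm T}\lambda]-x,\ g\in\partial f(x)\}$. Assume $\mathcal F(x,\lambda,z)$ is a convex set for every $(x,\lambda,z)\in\Omega\times\mathbb R^{nm}\times\mathbb R^{nm}$. Then (i) every solution $(x(t),\lambda(t),z(t))$ is bounded; (ii) for every solution, $x(t)$ converges to the optimal solution of the problem as $t\to\infty$.
   Context: $\partial f$ is the convex subdifferential; $P_\Omega$ the Euclidean projection onto $\Omega$. A solution is an absolutely continuous function on $[0,\infty)$ satisfying the inclusion for almost all $t$ (solutions are assumed to exist on $[0,\infty)$).
   Formalization: It is additionally assumed that the problem has an optimal solution; without this (i) fails, e.g. for one agent with Ω=ℝ, f=exp, W=0, d=0, where x(t)=−ln(1+t) is an unbounded solution. *)

theory Defs
  imports "HOL-Analysis.Analysis"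
begin

text \<open>Vectors of R^q are represented as functions nat => real vanishing from index q on.
  Agents are indexed by i < n; a global vector (x_1,...,x_n) is a function nat => nat => real.\<close>

definition Rn :: "nat \<Rightarrow> (nat \<Rightarrow> real) set" where
  "Rn q = {v. \<forall>k\<ge>q. v k = 0}"

definition ip :: "nat \<Rightarrow> (nat \<Rightarrow> real) \<Rightarrow> (nat \<Rightarrow> real) \<Rightarrow> real" where
  "ip q u v = (\<Sum>k<q. u k * v k)"

definition nrm :: "nat \<Rightarrow> (nat \<Rightarrow> real) \<Rightarrow> real" where
  "nrm q v = sqrt (ip q v v)"

definition comb :: "real \<Rightarrow> (nat \<Rightarrow> real) \<Rightarrow> (nat \<Rightarrow> real) \<Rightarrow> (nat \<Rightarrow> real)" where
  "comb \<theta> u v = (\<lambda>k. (1 - \<theta>) * u k + \<theta> * v k)"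

definition cvx_set :: "(nat \<Rightarrow> real) set \<Rightarrow> bool" where
  "cvx_set S = (\<forall>u\<in>S. \<forall>v\<in>S. \<forall>\<theta>::real. 0 \<le> \<theta> \<and> \<theta> \<le> 1 \<longrightarrow> comb \<theta> u v \<in> S)"

definition open_Rn :: "nat \<Rightarrow> (nat \<Rightarrow> real) set \<Rightarrow> bool" where
  "open_Rn q U = (U \<subseteq> Rn q \<and>
     (\<forall>u\<in>U. \<exists>e>0. \<forall>v\<in>Rn q. nrm q (\<lambda>k. v k - u k) < e \<longrightarrow> v \<in> U))"

definition closed_Rn :: "nat \<Rightarrow> (nat \<Rightarrow> real) set \<Rightarrow> bool" where
  "closed_Rn q S = (S \<subseteq> Rn q \<and> open_Rn q (Rn q - S))"

definition interior_Rn :: "nat \<Rightarrow> (nat \<Rightarrow> real) set \<Rightarrow> (nat \<Rightarrow> real) set" where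
  "interior_Rn q S = {u \<in> S. \<exists>e>0. \<forall>v\<in>Rn q. nrm q (\<lambda>k. v k - u k) < e \<longrightarrow> v \<in> S}"

text \<open>Strict convexity (same shape as the library's strict_convex_on).\<close>
definition strict_cvx_on :: "nat \<Rightarrow> (nat \<Rightarrow> real) set \<Rightarrow> ((nat \<Rightarrow> real) \<Rightarrow> real) \<Rightarrow> bool" where
  "strict_cvx_on q U h = (\<forall>u\<in>U. \<forall>v\<in>U. u \<noteq> v \<longrightarrow>
     (\<forall>\<theta>::real. 0 < \<theta> \<and> \<theta> < 1 \<longrightarrow> h (comb \<theta> u v) < (1 - \<theta>) * h u + \<theta> * h v))"

text \<open>Convex subdifferential of h (defined on the open domain U) at x.\<close>
definition subgrad :: "nat \<Rightarrow> (nat \<Rightarrow> real) set \<Rightarrow> ((nat \<Rightarrow> real) \<Rightarrow> real) \<Rightarrow> (nat \<Rightarrow> real) \<Rightarrow> (nat \<Rightarrow> real) set" where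
  "subgrad q U h x = {g \<in> Rn q. \<forall>y\<in>U. h y \<ge> h x + ip q g (\<lambda>k. y k - x k)}"

text \<open>Euclidean projection onto S (a closed convex nonempty subset of R^q).\<close>
definition proj :: "nat \<Rightarrow> (nat \<Rightarrow> real) set \<Rightarrow> (nat \<Rightarrow> real) \<Rightarrow> (nat \<Rightarrow> real)" where
  "proj q S y = (THE p. p \<in> S \<and> (\<forall>w\<in>S. nrm q (\<lambda>k. y k - p k) \<le> nrm q (\<lambda>k. y k - w k)))"

text \<open>W i r k: entry (r,k) of the m x q_i matrix W_i.\<close>
definition Wmul :: "nat \<Rightarrow> nat \<Rightarrow> (nat \<Rightarrow> nat \<Rightarrow> real) \<Rightarrow> (nat \<Rightarrow> real) \<Rightarrow> (nat \<Rightarrow> real)" where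
  "Wmul m qi Wi v = (\<lambda>r. if r < m then (\<Sum>k<qi. Wi r k * v k) else 0)"

definition WTmul :: "nat \<Rightarrow> nat \<Rightarrow> (nat \<Rightarrow> nat \<Rightarrow> real) \<Rightarrow> (nat \<Rightarrow> real) \<Rightarrow> (nat \<Rightarrow> real)" where
  "WTmul m qi Wi l = (\<lambda>k. if k < qi then (\<Sum>r<m. Wi r k * l r) else 0)"

text \<open>Laplacian action: (L y)_i = sum_j a_ij (y_i - y_j), restricted to the first m coordinates.\<close>
definition lap :: "nat \<Rightarrow> nat \<Rightarrow> (nat \<Rightarrow> nat \<Rightarrow> real) \<Rightarrow> (nat \<Rightarrow> nat \<Rightarrow> real) \<Rightarrow> nat \<Rightarrow> (nat \<Rightarrow> real)" where
  "lap n m a y i = (\<lambda>r. if r < m then (\<Sum>j<n. a i j * (y i r - y j r)) else 0)"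

text \<open>Undirected weighted graph on {0..<n}: symmetric nonnegative weights, no self loops, connected.\<close>
definition weighted_graph :: "nat \<Rightarrow> (nat \<Rightarrow> nat \<Rightarrow> real) \<Rightarrow> bool" where
  "weighted_graph n a = (\<forall>i<n. \<forall>j<n. a i j = a j i \<and> a i j \<ge> 0 \<and> a i i = 0)"

definition graph_connected :: "nat \<Rightarrow> (nat \<Rightarrow> nat \<Rightarrow> real) \<Rightarrow> bool" where
  "graph_connected n a = (\<forall>i<n. \<forall>j<n. (i, j) \<in> {(u, v). u < n \<and> v < n \<and> a u v > 0}\<^sup>*)"

text \<open>Canonical representations of Omega, of R^{q_1} x ... x R^{q_n}, and of R^{nm}.\<close>
definition Xset :: "nat \<Rightarrow> (nat \<Rightarrow> (nat \<Rightarrow> real) set) \<Rightarrow> (nat \<Rightarrow> nat \<Rightarrow> real) set" where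
  "Xset n Om = {x. (\<forall>i<n. x i \<in> Om i) \<and> (\<forall>i\<ge>n. x i = (\<lambda>_. 0))}"

definition Xspace :: "nat \<Rightarrow> (nat \<Rightarrow> nat) \<Rightarrow> (nat \<Rightarrow> nat \<Rightarrow> real) set" where
  "Xspace n q = Xset n (\<lambda>i. Rn (q i))"

definition Lspace :: "nat \<Rightarrow> nat \<Rightarrow> (nat \<Rightarrow> nat \<Rightarrow> real) set" where
  "Lspace n m = Xset n (\<lambda>_. Rn m)"

text \<open>The set-valued map F(x, lambda, z).\<close>
definition Fmap :: "nat \<Rightarrow> nat \<Rightarrow> (nat \<Rightarrow> nat) \<Rightarrow> (nat \<Rightarrow> nat \<Rightarrow> real)
    \<Rightarrow> (nat \<Rightarrow> (nat \<Rightarrow> real) set) \<Rightarrow> (nat \<Rightarrow> (nat \<Rightarrow> real) set) \<Rightarrow> (nat \<Rightarrow> (nat \<Rightarrow> real) \<Rightarrow> real)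
    \<Rightarrow> (nat \<Rightarrow> nat \<Rightarrow> nat \<Rightarrow> real) \<Rightarrow> (nat \<Rightarrow> nat \<Rightarrow> real)
    \<Rightarrow> (nat \<Rightarrow> nat \<Rightarrow> real) \<Rightarrow> (nat \<Rightarrow> nat \<Rightarrow> real) \<Rightarrow> (nat \<Rightarrow> nat \<Rightarrow> real)
    \<Rightarrow> ((nat \<Rightarrow> nat \<Rightarrow> real) \<times> (nat \<Rightarrow> nat \<Rightarrow> real) \<times> (nat \<Rightarrow> nat \<Rightarrow> real)) set" where
  "Fmap n m q a Om U f W d x l z =
     {(p, u, w) | p u w. \<exists>g. (\<forall>i<n. g i \<in> subgrad (q i) (U i) (f i) (x i)) \<and>
        p = (\<lambda>i. if i < n then (\<lambda>k. if k < q i then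
               proj (q i) (Om i) (\<lambda>k'. x i k' - g i k' + WTmul m (q i) (W i) (l i) k') k - x i k
             else 0) else (\<lambda>_. 0)) \<and>
        u = (\<lambda>i. if i < n then (\<lambda>r. if r < m then
               d i r - Wmul m (q i) (W i) (x i) r - lap n m a l i r - lap n m a z i r
               - Wmul m (q i) (W i) (p i) r
             else 0) else (\<lambda>_. 0)) \<and>
        w = (\<lambda>i. if i < n then lap n m a l i else (\<lambda>_. 0))}"

definition comb2 :: "real \<Rightarrow> (nat \<Rightarrow> nat \<Rightarrow> real) \<Rightarrow> (nat \<Rightarrow> nat \<Rightarrow> real) \<Rightarrow> (nat \<Rightarrow> nat \<Rightarrow> real)" where
  "comb2 \<theta> u v = (\<lambda>i k. (1 - \<theta>) * u i k + \<theta> * v i k)"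

definition cvx_set3 :: "((nat \<Rightarrow> nat \<Rightarrow> real) \<times> (nat \<Rightarrow> nat \<Rightarrow> real) \<times> (nat \<Rightarrow> nat \<Rightarrow> real)) set \<Rightarrow> bool" where
  "cvx_set3 S = (\<forall>p1 u1 w1 p2 u2 w2. (p1, u1, w1) \<in> S \<longrightarrow> (p2, u2, w2) \<in> S \<longrightarrow>
      (\<forall>\<theta>::real. 0 \<le> \<theta> \<and> \<theta> \<le> 1 \<longrightarrow> (comb2 \<theta> p1 p2, comb2 \<theta> u1 u2, comb2 \<theta> w1 w2) \<in> S))"

text \<open>Absolute continuity of a real function on a set S (finite families of nonoverlapping intervals).\<close>
definition abs_cont_on :: "real set \<Rightarrow> (real \<Rightarrow> real) \<Rightarrow> bool" where
  "abs_cont_on S h = (\<forall>e>0. \<exists>\<delta>>0. \<forall>(N::nat) (\<alpha>::nat \<Rightarrow> real) \<beta>.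
      (\<forall>k<N. \<alpha> k \<le> \<beta> k \<and> {\<alpha> k..\<beta> k} \<subseteq> S) \<and>
      (\<forall>k<N. \<forall>k'<N. k \<noteq> k' \<longrightarrow> \<beta> k \<le> \<alpha> k' \<or> \<beta> k' \<le> \<alpha> k) \<and>
      (\<Sum>k<N. \<beta> k - \<alpha> k) < \<delta> \<longrightarrow> (\<Sum>k<N. \<bar>h (\<beta> k) - h (\<alpha> k)\<bar>) < e)"

text \<open>Solution of the inclusion (dx, dl, dz) \<in> F(x, l, z) on [0, \<infinity>): absolutely continuous
  (on every compact [0,T]) and satisfying the inclusion for almost all t.\<close>
definition is_solution :: "nat \<Rightarrow> nat \<Rightarrow> (nat \<Rightarrow> nat) \<Rightarrow> (nat \<Rightarrow> nat \<Rightarrow> real)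
    \<Rightarrow> (nat \<Rightarrow> (nat \<Rightarrow> real) set) \<Rightarrow> (nat \<Rightarrow> (nat \<Rightarrow> real) set) \<Rightarrow> (nat \<Rightarrow> (nat \<Rightarrow> real) \<Rightarrow> real)
    \<Rightarrow> (nat \<Rightarrow> nat \<Rightarrow> nat \<Rightarrow> real) \<Rightarrow> (nat \<Rightarrow> nat \<Rightarrow> real)
    \<Rightarrow> (real \<Rightarrow> nat \<Rightarrow> nat \<Rightarrow> real) \<Rightarrow> (real \<Rightarrow> nat \<Rightarrow> nat \<Rightarrow> real) \<Rightarrow> (real \<Rightarrow> nat \<Rightarrow> nat \<Rightarrow> real) \<Rightarrow> bool" where
  "is_solution n m q a Om U f W d x l z =
     ((\<forall>t\<ge>0. x t \<in> Xspace n q \<and> l t \<in> Lspace n m \<and> z t \<in> Lspace n m) \<and>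
      (\<forall>T\<ge>0. \<forall>i<n. (\<forall>k<q i. abs_cont_on {0..T} (\<lambda>t. x t i k)) \<and>
                   (\<forall>r<m. abs_cont_on {0..T} (\<lambda>t. l t i r) \<and> abs_cont_on {0..T} (\<lambda>t. z t i r))) \<and>
      (AE t in lebesgue. t > 0 \<longrightarrow>
         (\<exists>p u w. (p, u, w) \<in> Fmap n m q a Om U f W d (x t) (l t) (z t) \<and>
            (\<forall>i<n. (\<forall>k<q i. ((\<lambda>s. x s i k) has_real_derivative p i k) (at t)) \<and>
                   (\<forall>r<m. ((\<lambda>s. l s i r) has_real_derivative u i r) (at t) \<and>
                          ((\<lambda>s. z s i r) has_real_derivative w i r) (at t))))))"

text \<open>Optimal solution of  min sum_i f_i(x_i)  s.t.  sum_i W_i x_i = sum_i d_i,  x in Omega.\<close>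
definition feasible :: "nat \<Rightarrow> nat \<Rightarrow> (nat \<Rightarrow> nat) \<Rightarrow> (nat \<Rightarrow> (nat \<Rightarrow> real) set)
    \<Rightarrow> (nat \<Rightarrow> nat \<Rightarrow> nat \<Rightarrow> real) \<Rightarrow> (nat \<Rightarrow> nat \<Rightarrow> real) \<Rightarrow> (nat \<Rightarrow> nat \<Rightarrow> real) \<Rightarrow> bool" where
  "feasible n m q Om W d x = (x \<in> Xset n Om \<and>
     (\<forall>r<m. (\<Sum>i<n. Wmul m (q i) (W i) (x i) r) = (\<Sum>i<n. d i r)))"

definition is_optimal :: "nat \<Rightarrow> nat \<Rightarrow> (nat \<Rightarrow> nat) \<Rightarrow> (nat \<Rightarrow> (nat \<Rightarrow> real) set)
    \<Rightarrow> (nat \<Rightarrow> (nat \<Rightarrow> real) \<Rightarrow> real) \<Rightarrow> (nat \<Rightarrow> nat \<Rightarrow> nat \<Rightarrow> real) \<Rightarrow> (nat \<Rightarrow> nat \<Rightarrow> real)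
    \<Rightarrow> (nat \<Rightarrow> nat \<Rightarrow> real) \<Rightarrow> bool" where
  "is_optimal n m q Om f W d xs = (feasible n m q Om W d xs \<and>
     (\<forall>y. feasible n m q Om W d y \<longrightarrow> (\<Sum>i<n. f i (xs i)) \<le> (\<Sum>i<n. f i (y i))))"

end

theory Submission
  imports Defs
begin

text \<open>
  Slater's condition gives a multiplier \<open>\<mu>\<close> for the coupling constraint, so the Lagrangian gap
  \<open>gap y = f y - f x\<^sup>* - \<mu> \<cdot> (W y - d\<^sub>0)\<close> is nonnegative on \<open>\<Omega>\<close>, and by strict convexity it vanishes
  only at the optimum \<open>x\<^sup>*\<close>.  Connectedness gives \<open>z\<^sup>*\<close> whose Laplacian image is the vector of
  local residuals \<open>d\<^sub>i - W\<^sub>i x\<^sup>*\<^sub>i\<close>.  Combining the variational inequality of the projection at \<open>x\<^sup>*\<close>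
  with the subgradient inequality, the function
  \<open>V = gap x + (|x - x\<^sup>*|\<^sup>2 + |\<lambda> - \<mu>|\<^sup>2 + |z - z\<^sup>*|\<^sup>2) / 2\<close> satisfies
  \<open>V' \<le> - |x'|\<^sup>2 - gap x\<close> along solutions, which bounds them.  Since \<open>\<plusminus> v \<le> v\<^sup>2 + 1/4\<close>, the first term also
  controls the increments of \<open>x\<close> by the decrease of \<open>V\<close>; hence \<open>x\<close> cannot return infinitely often to
  a distance \<open>\<epsilon>\<close> from \<open>x\<^sup>*\<close> without the gap term consuming a fixed amount of \<open>V\<close> each time.

  The function \<open>f \<circ> x\<close> need not be known to be differentiable: a subgradient at time \<open>t\<close> bounds the
  differences \<open>f (x t) - f (x s)\<close> from above, and for absolutely continuous functions such a
  bound on left difference quotients at almost every time is enough for monotonicity.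
\<close>

section \<open>Absolutely continuous functions\<close>

lemma abs_cont_onE:
  assumes "abs_cont_on S h" "e > 0"
  obtains \<delta> where "\<delta> > 0" and "\<And>(N::nat) \<alpha> \<beta>. (\<forall>k<N. \<alpha> k \<le> \<beta> k \<and> {\<alpha> k..\<beta> k} \<subseteq> S) \<and>
      (\<forall>k<N. \<forall>k'<N. k \<noteq> k' \<longrightarrow> \<beta> k \<le> \<alpha> k' \<or> \<beta> k' \<le> \<alpha> k) \<and>
      (\<Sum>k<N. \<beta> k - \<alpha> k) < \<delta> \<Longrightarrow> (\<Sum>k<N. \<bar>h (\<beta> k) - h (\<alpha> k)\<bar>) < e"
proof -
  from assms(1)[unfolded abs_cont_on_def, rule_format, OF assms(2)] show thesis
    by (elim exE conjE) (rule that, assumption, iprover)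
qed

lemma abs_cont_on_subset:
  assumes "abs_cont_on S h" "T \<subseteq> S"
  shows "abs_cont_on T h"
  unfolding abs_cont_on_def
proof (intro allI impI)
  fix e :: real assume "e > 0"
  then obtain \<delta> where "\<delta> > 0" and \<delta>: "\<And>(N::nat) \<alpha> \<beta>. (\<forall>k<N. \<alpha> k \<le> \<beta> k \<and> {\<alpha> k..\<beta> k} \<subseteq> S) \<and>
      (\<forall>k<N. \<forall>k'<N. k \<noteq> k' \<longrightarrow> \<beta> k \<le> \<alpha> k' \<or> \<beta> k' \<le> \<alpha> k) \<and>
      (\<Sum>k<N. \<beta> k - \<alpha> k) < \<delta> \<Longrightarrow> (\<Sum>k<N. \<bar>h (\<beta> k) - h (\<alpha> k)\<bar>) < e"
    using abs_cont_onE[OF assms(1)] by blast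
  show "\<exists>\<delta>>0. \<forall>(N::nat) \<alpha> \<beta>. (\<forall>k<N. \<alpha> k \<le> \<beta> k \<and> {\<alpha> k..\<beta> k} \<subseteq> T) \<and>
      (\<forall>k<N. \<forall>k'<N. k \<noteq> k' \<longrightarrow> \<beta> k \<le> \<alpha> k' \<or> \<beta> k' \<le> \<alpha> k) \<and>
      (\<Sum>k<N. \<beta> k - \<alpha> k) < \<delta> \<longrightarrow> (\<Sum>k<N. \<bar>h (\<beta> k) - h (\<alpha> k)\<bar>) < e"
  proof (intro exI[of _ \<delta>] conjI \<open>\<delta> > 0\<close> allI impI)
    fix N :: nat and \<alpha> \<beta> :: "nat \<Rightarrow> real"
    assume A: "(\<forall>k<N. \<alpha> k \<le> \<beta> k \<and> {\<alpha> k..\<beta> k} \<subseteq> T) \<and>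
      (\<forall>k<N. \<forall>k'<N. k \<noteq> k' \<longrightarrow> \<beta> k \<le> \<alpha> k' \<or> \<beta> k' \<le> \<alpha> k) \<and> (\<Sum>k<N. \<beta> k - \<alpha> k) < \<delta>"
    then have "\<forall>k<N. \<alpha> k \<le> \<beta> k \<and> {\<alpha> k..\<beta> k} \<subseteq> S" using assms(2) by blast
    then show "(\<Sum>k<N. \<bar>h (\<beta> k) - h (\<alpha> k)\<bar>) < e" using A by (intro \<delta>) simp
  qed
qed

text \<open>A common \<delta>, the least of those that the finitely many \<open>y j\<close> need for
  a reduced tolerance, bounds every sum of increments of \<open>h\<close>. Sums, multiples, squares
  and compositions with locally Lipschitz functions all reduce to this.\<close>

lemma abs_cont_on_dominated:
  fixes y :: "'j \<Rightarrow> real \<Rightarrow> real"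
  assumes fin: "finite I" and ac: "\<And>j. j \<in> I \<Longrightarrow> abs_cont_on S (y j)"
    and dom: "\<And>s t. s \<in> S \<Longrightarrow> t \<in> S \<Longrightarrow> \<bar>h s - h t\<bar> \<le> M * (\<Sum>j\<in>I. \<bar>y j s - y j t\<bar>)"
  shows "abs_cont_on S h"
  unfolding abs_cont_on_def
proof (intro allI impI)
  fix e :: real assume e: "e > 0"
  \<comment> \<open>The constant \<open>M\<close> may be zero or negative, so it is replaced by a
    positive majorant. The summand 1 next to \<open>card I\<close> covers the empty index set and
    makes the final estimate strict.\<close>
  define M' where "M' = \<bar>M\<bar> + 1"
  have M': "M' > 0" "M \<le> M'" by (auto simp: M'_def)
  define e' where "e' = e / (M' * (real (card I) + 1))"
  have e': "e' > 0" using e M' by (simp add: e'_def)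
  have "\<forall>j\<in>I. \<exists>\<delta>>0. \<forall>(N::nat) \<alpha> \<beta>. (\<forall>k<N. \<alpha> k \<le> \<beta> k \<and> {\<alpha> k..\<beta> k} \<subseteq> S) \<and>
      (\<forall>k<N. \<forall>k'<N. k \<noteq> k' \<longrightarrow> \<beta> k \<le> \<alpha> k' \<or> \<beta> k' \<le> \<alpha> k) \<and>
      (\<Sum>k<N. \<beta> k - \<alpha> k) < \<delta> \<longrightarrow> (\<Sum>k<N. \<bar>y j (\<beta> k) - y j (\<alpha> k)\<bar>) < e'"
    using ac e' unfolding abs_cont_on_def by blast
  then obtain D where D: "\<forall>j\<in>I. D j > 0 \<and> (\<forall>(N::nat) \<alpha> \<beta>. (\<forall>k<N. \<alpha> k \<le> \<beta> k \<and> {\<alpha> k..\<beta> k} \<subseteq> S) \<and>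
      (\<forall>k<N. \<forall>k'<N. k \<noteq> k' \<longrightarrow> \<beta> k \<le> \<alpha> k' \<or> \<beta> k' \<le> \<alpha> k) \<and>
      (\<Sum>k<N. \<beta> k - \<alpha> k) < D j \<longrightarrow> (\<Sum>k<N. \<bar>y j (\<beta> k) - y j (\<alpha> k)\<bar>) < e')"
    by (rule bchoice[THEN exE])
  define \<delta> where "\<delta> = Min (insert 1 (D ` I))"
  have \<delta>: "\<delta> > 0" "\<And>j. j \<in> I \<Longrightarrow> \<delta> \<le> D j"
    using fin D by (auto simp: \<delta>_def)
  show "\<exists>\<delta>>0. \<forall>(N::nat) \<alpha> \<beta>. (\<forall>k<N. \<alpha> k \<le> \<beta> k \<and> {\<alpha> k..\<beta> k} \<subseteq> S) \<and>
      (\<forall>k<N. \<forall>k'<N. k \<noteq> k' \<longrightarrow> \<beta> k \<le> \<alpha> k' \<or> \<beta> k' \<le> \<alpha> k) \<and>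
      (\<Sum>k<N. \<beta> k - \<alpha> k) < \<delta> \<longrightarrow> (\<Sum>k<N. \<bar>h (\<beta> k) - h (\<alpha> k)\<bar>) < e"
  proof (intro exI[of _ \<delta>] conjI \<delta>(1) allI impI)
    fix N :: nat and \<alpha> \<beta> :: "nat \<Rightarrow> real"
    assume A: "(\<forall>k<N. \<alpha> k \<le> \<beta> k \<and> {\<alpha> k..\<beta> k} \<subseteq> S) \<and>
      (\<forall>k<N. \<forall>k'<N. k \<noteq> k' \<longrightarrow> \<beta> k \<le> \<alpha> k' \<or> \<beta> k' \<le> \<alpha> k) \<and>
      (\<Sum>k<N. \<beta> k - \<alpha> k) < \<delta>"
    have each: "(\<Sum>k<N. \<bar>y j (\<beta> k) - y j (\<alpha> k)\<bar>) < e'" if "j \<in> I" for j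
    proof -
      have "(\<Sum>k<N. \<beta> k - \<alpha> k) < D j" using A \<delta>(2)[OF that] by linarith
      then show ?thesis using D that A by blast
    qed
    have "(\<Sum>k<N. \<bar>h (\<beta> k) - h (\<alpha> k)\<bar>) \<le> (\<Sum>k<N. M' * (\<Sum>j\<in>I. \<bar>y j (\<beta> k) - y j (\<alpha> k)\<bar>))"
    proof (rule sum_mono)
      fix k assume "k \<in> {..<N}"
      then have "\<alpha> k \<le> \<beta> k" "{\<alpha> k..\<beta> k} \<subseteq> S" using A by blast+
      then have "\<alpha> k \<in> S" "\<beta> k \<in> S" by auto
      then have "\<bar>h (\<beta> k) - h (\<alpha> k)\<bar> \<le> M * (\<Sum>j\<in>I. \<bar>y j (\<beta> k) - y j (\<alpha> k)\<bar>)" by (intro dom)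
      also have "\<dots> \<le> M' * (\<Sum>j\<in>I. \<bar>y j (\<beta> k) - y j (\<alpha> k)\<bar>)"
        by (intro mult_right_mono M' sum_nonneg) auto
      finally show "\<bar>h (\<beta> k) - h (\<alpha> k)\<bar> \<le> M' * (\<Sum>j\<in>I. \<bar>y j (\<beta> k) - y j (\<alpha> k)\<bar>)" .
    qed
    also have "\<dots> = M' * (\<Sum>j\<in>I. \<Sum>k<N. \<bar>y j (\<beta> k) - y j (\<alpha> k)\<bar>)"
      by (subst sum.swap) (simp add: sum_distrib_left)
    also have "\<dots> \<le> M' * (\<Sum>j\<in>I. e')"
      by (intro mult_left_mono sum_mono) (use each M' in \<open>auto intro: less_imp_le\<close>)
    also have "\<dots> = M' * (real (card I) * e')" by simp
    also have "\<dots> < M' * ((real (card I) + 1) * e')"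
      using M' e' by (intro mult_strict_left_mono) (auto simp: algebra_simps)
    also have "\<dots> = e" using M' by (simp add: e'_def)
    finally show "(\<Sum>k<N. \<bar>h (\<beta> k) - h (\<alpha> k)\<bar>) < e" .
  qed
qed

lemma abs_cont_on_sum:
  assumes "finite I" "\<And>j. j \<in> I \<Longrightarrow> abs_cont_on S (y j)"
  shows "abs_cont_on S (\<lambda>t. \<Sum>j\<in>I. y j t)"
proof (rule abs_cont_on_dominated[OF assms, where M = 1])
  fix s t
  show "\<bar>(\<Sum>j\<in>I. y j s) - (\<Sum>j\<in>I. y j t)\<bar> \<le> 1 * (\<Sum>j\<in>I. \<bar>y j s - y j t\<bar>)"
    by (simp add: sum_subtractf[symmetric] sum_abs)
qed auto

lemma abs_cont_on_add:
  assumes "abs_cont_on S h" "abs_cont_on S k"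
  shows "abs_cont_on S (\<lambda>t. h t + k t)"
proof -
  have "abs_cont_on S (\<lambda>t. \<Sum>b\<in>UNIV. (if b then h else k) t)"
    by (rule abs_cont_on_sum) (use assms in auto)
  then show ?thesis by (simp add: UNIV_bool add.commute)
qed

lemma abs_cont_on_const: "abs_cont_on S (\<lambda>t. c)"
  by (auto simp: abs_cont_on_def intro: exI[of _ 1])

lemma abs_cont_on_cmult:
  assumes "abs_cont_on S h"
  shows "abs_cont_on S (\<lambda>t. c * h t)"
  by (rule abs_cont_on_dominated[where I = "{()}" and y = "\<lambda>_. h" and M = "\<bar>c\<bar>"])
     (use assms in \<open>auto simp: abs_mult[symmetric] right_diff_distrib\<close>)

lemma abs_cont_on_diff:
  assumes "abs_cont_on S h" "abs_cont_on S k"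
  shows "abs_cont_on S (\<lambda>t. h t - k t)"
  using abs_cont_on_add[OF assms(1) abs_cont_on_cmult[OF assms(2), of "-1"]] by simp

lemma abs_cont_on_ident: "abs_cont_on S (\<lambda>t. t)"
  unfolding abs_cont_on_def
proof (intro allI impI)
  fix e :: real assume "e > 0"
  then show "\<exists>\<delta>>0. \<forall>(N::nat) \<alpha> \<beta>. (\<forall>k<N. \<alpha> k \<le> \<beta> k \<and> {\<alpha> k..\<beta> k} \<subseteq> S) \<and>
      (\<forall>k<N. \<forall>k'<N. k \<noteq> k' \<longrightarrow> \<beta> k \<le> \<alpha> k' \<or> \<beta> k' \<le> \<alpha> k) \<and>
      (\<Sum>k<N. \<beta> k - \<alpha> k) < \<delta> \<longrightarrow> (\<Sum>k<N. \<bar>\<beta> k - \<alpha> k\<bar>) < e"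
    by (intro exI[of _ e]) (auto simp: abs_of_nonneg)
qed

lemma abs_cont_on_imp_continuous_on:
  assumes "abs_cont_on {a..b} h"
  shows "continuous_on {a..b} h"
  unfolding continuous_on_iff
proof (intro ballI allI impI)
  fix x e :: real assume x: "x \<in> {a..b}" and "e > 0"
  then obtain \<delta> where "\<delta> > 0" and \<delta>: "\<And>(N::nat) \<alpha> \<beta>. (\<forall>k<N. \<alpha> k \<le> \<beta> k \<and> {\<alpha> k..\<beta> k} \<subseteq> {a..b}) \<and>
      (\<forall>k<N. \<forall>k'<N. k \<noteq> k' \<longrightarrow> \<beta> k \<le> \<alpha> k' \<or> \<beta> k' \<le> \<alpha> k) \<and>
      (\<Sum>k<N. \<beta> k - \<alpha> k) < \<delta> \<Longrightarrow> (\<Sum>k<N. \<bar>h (\<beta> k) - h (\<alpha> k)\<bar>) < e"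
    using abs_cont_onE[OF assms] by blast
  \<comment> \<open>The interval between the two points is a family with one member;
    \<open>min\<close> and \<open>max\<close> treat both orders at once.\<close>
  have "dist (h y) (h x) < e" if "y \<in> {a..b}" "dist y x < \<delta>" for y
    using \<delta>[of 1 "\<lambda>_. min x y" "\<lambda>_. max x y"] that x
    by (cases "x \<le> y") (auto simp: dist_real_def abs_minus_commute)
  then show "\<exists>d>0. \<forall>x'\<in>{a..b}. dist x' x < d \<longrightarrow> dist (h x') (h x) < e"
    using \<open>\<delta> > 0\<close> by blast
qed

text \<open>On a compact interval \<open>h\<close> is bounded by some \<open>B\<close>, and
  factoring the difference of squares gives domination with constant \<open>2 * B\<close>.\<close>

lemma abs_cont_on_power2:
  assumes "abs_cont_on {a..b} h"
  shows "abs_cont_on {a..b} (\<lambda>t. (h t)\<^sup>2)"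
proof -
  have "compact (h ` {a..b})"
    by (intro compact_continuous_image abs_cont_on_imp_continuous_on assms) auto
  then have "bounded (h ` {a..b})" by (rule compact_imp_bounded)
  then obtain B where B: "\<forall>t\<in>{a..b}. \<bar>h t\<bar> \<le> B"
    unfolding bounded_iff by auto
  show ?thesis
  proof (rule abs_cont_on_dominated[where I = "{()}" and y = "\<lambda>_. h" and M = "2 * B"])
    fix s t assume "s \<in> {a..b}" "t \<in> {a..b}"
    then have "\<bar>h s + h t\<bar> \<le> 2 * B" using B by (smt (verit))
    moreover have "\<bar>(h s)\<^sup>2 - (h t)\<^sup>2\<bar> = \<bar>h s + h t\<bar> * \<bar>h s - h t\<bar>"
      by (simp add: abs_mult[symmetric] power2_eq_square algebra_simps)
    ultimately show "\<bar>(h s)\<^sup>2 - (h t)\<^sup>2\<bar> \<le> 2 * B * (\<Sum>j\<in>{()}. \<bar>h s - h t\<bar>)"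
      by (simp add: mult_right_mono)
  qed (use assms in auto)
qed

section \<open>Monotonicity from one-sided bounds at almost every time\<close>

text \<open>The closed intervals may share end points; their interiors are disjoint and have the
  same lengths, so additivity of the measure applies to them.\<close>

lemma sum_length_nonoverlapping_le_measure:
  fixes \<alpha> \<beta> :: "nat \<Rightarrow> real"
  assumes G: "open G" "G \<in> lmeasurable"
    and sub: "\<forall>k<N. \<alpha> k \<le> \<beta> k \<and> {\<alpha> k..\<beta> k} \<subseteq> G"
    and no: "\<forall>k<N. \<forall>k'<N. k \<noteq> k' \<longrightarrow> \<beta> k \<le> \<alpha> k' \<or> \<beta> k' \<le> \<alpha> k"
  shows "(\<Sum>k<N. \<beta> k - \<alpha> k) \<le> measure lebesgue G"
proof -
  have "(\<Sum>k<N. \<beta> k - \<alpha> k) = (\<Sum>k<N. measure lebesgue {\<alpha> k<..<\<beta> k})"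
    using sub by (intro sum.cong) auto
  also have "\<dots> = measure lebesgue (\<Union>k<N. {\<alpha> k<..<\<beta> k})"
  proof (rule measure_finite_Union[symmetric])
    show "disjoint_family_on (\<lambda>k. {\<alpha> k<..<\<beta> k}) {..<N}"
      unfolding disjoint_family_on_def
    proof (intro ballI impI)
      fix k k' assume "k \<in> {..<N}" "k' \<in> {..<N}" "k \<noteq> k'"
      then have "\<beta> k \<le> \<alpha> k' \<or> \<beta> k' \<le> \<alpha> k" using no by auto
      then show "{\<alpha> k<..<\<beta> k} \<inter> {\<alpha> k'<..<\<beta> k'} = {}" by auto
    qed
  qed (use sub in auto)
  also have "\<dots> \<le> measure lebesgue G"
    by (rule measure_mono_fmeasurable) (use sub G in \<open>auto 4 4 simp: subset_iff\<close>)
  finally show ?thesis .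
qed

text \<open>A left difference bound is all a subgradient supplies.  Inside an open set \<open>G\<close> of small
  measure covering the exceptional times, the variation of \<open>h\<close> is absorbed by the monotone
  function \<open>\<psi>\<close>; the rest is a real induction running from the right end to the left.\<close>

lemma abs_cont_on_left_diff_imp_le:
  fixes h :: "real \<Rightarrow> real"
  assumes "a \<le> b" and ac: "abs_cont_on {a..b} h"
    and ae: "AE t in lebesgue. a < t \<and> t < b \<longrightarrow>
      (\<forall>\<epsilon>>0. \<exists>\<eta>>0. \<forall>u. t - \<eta> < u \<and> u < t \<and> a \<le> u \<longrightarrow> h t - h u \<le> \<epsilon> * (t - u))"
  shows "h b \<le> h a"
proof -
  have key: "h b - h a \<le> \<epsilon> * (b - a) + \<epsilon>" if \<epsilon>: "\<epsilon> > 0" for \<epsilon>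
  proof -
    obtain \<delta> where "\<delta> > 0" and \<delta>: "\<And>(N::nat) \<alpha> \<beta>. (\<forall>k<N. \<alpha> k \<le> \<beta> k \<and> {\<alpha> k..\<beta> k} \<subseteq> {a..b}) \<and>
      (\<forall>k<N. \<forall>k'<N. k \<noteq> k' \<longrightarrow> \<beta> k \<le> \<alpha> k' \<or> \<beta> k' \<le> \<alpha> k) \<and>
      (\<Sum>k<N. \<beta> k - \<alpha> k) < \<delta> \<Longrightarrow> (\<Sum>k<N. \<bar>h (\<beta> k) - h (\<alpha> k)\<bar>) < \<epsilon>"
      using abs_cont_onE[OF ac \<epsilon>] by blast
    obtain N0 where N0: "\<And>t. t \<notin> N0 \<Longrightarrow> a < t \<and> t < b \<longrightarrow>
      (\<forall>\<epsilon>>0. \<exists>\<eta>>0. \<forall>u. t - \<eta> < u \<and> u < t \<and> a \<le> u \<longrightarrow> h t - h u \<le> \<epsilon> * (t - u))"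
      "N0 \<in> null_sets lebesgue"
      using AE_E3[OF ae] by auto
    \<comment> \<open>The end points join the exceptional set because the hypothesis speaks of
      interior times only, whereas the induction below starts at \<open>b\<close>.\<close>
    define N1 where "N1 = N0 \<union> {a, b}"
    have N1: "N1 \<in> null_sets lebesgue"
      unfolding N1_def by (intro null_sets.Un N0) (auto intro: finite_imp_null_set_lborel null_sets_completionI)
    \<comment> \<open>Outer regularity: the null set lies in an open set of measure below \<delta>,
      so that the variation of \<open>h\<close> inside this set is at most \<epsilon>.\<close>
    obtain G where G: "open G" "N1 \<subseteq> G" "G - N1 \<in> lmeasurable" "emeasure lebesgue (G - N1) < ennreal \<delta>"
      using sets_lebesgue_outer_open[of N1 \<delta>] N1 \<open>\<delta> > 0\<close> by auto
    have Gm: "G \<in> lmeasurable"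
      using G(3) N1 G(1) by (metis borel_open measurable_Diff_null_set sets_completionI_sets sets_lborel)
    have "measure lebesgue G < \<delta>"
    proof -
      have "emeasure lebesgue G = emeasure lebesgue (G - N1)"
        using emeasure_Diff_null_set[OF N1, of G] Gm by auto
      then show ?thesis using G(4) Gm \<open>\<delta> > 0\<close>
        by (metis emeasure_eq_measure2 ennreal_less_iff measure_nonneg)
    qed
    \<comment> \<open>The value \<open>\<psi> t\<close> will be the variation of \<open>h\<close>
      over finite families of nonoverlapping intervals inside
      \<open>{a..t} \<inter> G\<close>.\<close>
    define fam where "fam t N \<alpha> \<beta> \<longleftrightarrow> (\<forall>k<N. \<alpha> k \<le> \<beta> k \<and> {\<alpha> k..\<beta> k} \<subseteq> {a..t} \<inter> G) \<and>
      (\<forall>k<N. \<forall>k'<N. k \<noteq> k' \<longrightarrow> \<beta> k \<le> \<alpha> k' \<or> \<beta> k' \<le> \<alpha> k)" for t and N :: nat and \<alpha> \<beta> :: "nat \<Rightarrow> real"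
    define vs where "vs t = {\<Sum>k<N. \<bar>h (\<beta> k) - h (\<alpha> k)\<bar> | N \<alpha> \<beta>. fam t N \<alpha> \<beta>}" for t
    define \<psi> where "\<psi> t = Sup (vs t)" for t
    have bound: "v \<le> \<epsilon>" if v: "v \<in> vs t" "t \<le> b" for v t
    proof -
      obtain N \<alpha> \<beta> where f: "fam t N \<alpha> \<beta>" and v_eq: "v = (\<Sum>k<N. \<bar>h (\<beta> k) - h (\<alpha> k)\<bar>)"
        using v by (auto simp: vs_def)
      have "(\<Sum>k<N. \<beta> k - \<alpha> k) \<le> measure lebesgue G"
        using f by (intro sum_length_nonoverlapping_le_measure G Gm) (auto simp: fam_def)
      then have "(\<Sum>k<N. \<beta> k - \<alpha> k) < \<delta>" using \<open>measure lebesgue G < \<delta>\<close> by simp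
      moreover have "{a..t} \<subseteq> {a..b}" using v by auto
      ultimately have "(\<Sum>k<N. \<bar>h (\<beta> k) - h (\<alpha> k)\<bar>) < \<epsilon>"
        using f unfolding fam_def by (intro \<delta>) blast
      then show ?thesis using v_eq by simp
    qed
    have zero: "0 \<in> vs t" for t
      unfolding vs_def by (rule CollectI, rule exI[of _ 0]) (auto simp: fam_def)
    have bdd: "bdd_above (vs t)" if "t \<le> b" for t
      using bound that by (meson bdd_aboveI)
    have \<psi>_nonneg: "0 \<le> \<psi> t" if "t \<le> b" for t
      unfolding \<psi>_def by (intro cSup_upper zero bdd that)
    have \<psi>_le: "\<psi> t \<le> \<epsilon>" if "t \<le> b" for t
      unfolding \<psi>_def using zero bound[OF _ that] by (intro cSup_least) auto
    have \<psi>_mono: "\<psi> u \<le> \<psi> t" if "u \<le> t" "t \<le> b" for u t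
    proof -
      have "{a..u} \<subseteq> {a..t}" using that by auto
      then have "fam u N \<alpha> \<beta> \<Longrightarrow> fam t N \<alpha> \<beta>" for N \<alpha> \<beta> unfolding fam_def by blast
      then have "vs u \<subseteq> vs t" unfolding vs_def by blast
      then show ?thesis unfolding \<psi>_def using zero by (intro cSup_subset_mono bdd that) auto
    qed
    have \<psi>_jump: "\<psi> u + \<bar>h t - h u\<bar> \<le> \<psi> t" if ut: "a \<le> u" "u \<le> t" "t \<le> b" "{u..t} \<subseteq> G" for u t
    proof -
      have "v + \<bar>h t - h u\<bar> \<le> \<psi> t" if vu: "v \<in> vs u" for v
      proof -
        obtain N \<alpha> \<beta> where f: "fam u N \<alpha> \<beta>" and v: "v = (\<Sum>k<N. \<bar>h (\<beta> k) - h (\<alpha> k)\<bar>)"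
          using vu unfolding vs_def by blast
        have before: "\<beta> k \<le> u" if "k < N" for k
        proof -
          have "\<alpha> k \<le> \<beta> k" "{\<alpha> k..\<beta> k} \<subseteq> {a..u}" using f that unfolding fam_def by blast+
          then show ?thesis by auto
        qed
        have sub: "{a..u} \<subseteq> {a..t}" using ut by auto
        have new: "{u..t} \<subseteq> {a..t} \<inter> G" using ut by auto
        \<comment> \<open>The interval from \<open>u\<close> to \<open>t\<close> is appended with
          index \<open>N\<close>; all earlier intervals end at \<open>u\<close> or before.\<close>
        have "fam t (Suc N) (\<alpha>(N := u)) (\<beta>(N := t))"
          using f sub new ut before order_trans[OF before ut(2)] unfolding fam_def by (auto simp: less_Suc_eq)
        then have "(\<Sum>k<Suc N. \<bar>h ((\<beta>(N := t)) k) - h ((\<alpha>(N := u)) k)\<bar>) \<in> vs t"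
          unfolding vs_def by blast
        moreover have "(\<Sum>k<Suc N. \<bar>h ((\<beta>(N := t)) k) - h ((\<alpha>(N := u)) k)\<bar>) = v + \<bar>h t - h u\<bar>"
          by (simp add: v)
        ultimately show ?thesis unfolding \<psi>_def using bdd ut by (metis cSup_upper)
      qed
      then have "\<psi> u \<le> \<psi> t - \<bar>h t - h u\<bar>"
        unfolding \<psi>_def[of u] using zero by (intro cSup_least) (auto simp: le_diff_eq)
      then show ?thesis by simp
    qed
    \<comment> \<open>Slightly to the left of any \<open>t\<close>, the values of \<open>H\<close>
      are at least \<open>H t\<close>: near an exceptional time the growth of \<psi> pays for any
      increase of \<open>h\<close>, and at other times the slope \<epsilon> does.\<close>
    define H where "H t = h t - \<epsilon> * t - \<psi> t" for t
    have left: "\<exists>\<eta>>0. \<forall>u. t - \<eta> < u \<and> u < t \<and> a \<le> u \<longrightarrow> H t \<le> H u" if t: "a < t" "t \<le> b" for t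
    proof (cases "t \<in> N1")
      case True
      then obtain \<eta> where \<eta>: "\<eta> > 0" "\<And>y. dist y t < \<eta> \<Longrightarrow> y \<in> G"
        using G unfolding open_dist by blast
      have "H t \<le> H u" if u: "t - \<eta> < u" "u < t" "a \<le> u" for u
      proof -
        have "{u..t} \<subseteq> G" using \<eta>(2) u by (auto simp: dist_real_def)
        then have "\<psi> u + \<bar>h t - h u\<bar> \<le> \<psi> t" using u t by (intro \<psi>_jump) auto
        moreover have "\<epsilon> * u \<le> \<epsilon> * t" using \<epsilon> u by auto
        ultimately show ?thesis unfolding H_def by linarith
      qed
      then show ?thesis using \<eta>(1) by blast
    next
      case False
      then have "t < b" "t \<notin> N0" using t by (auto simp: N1_def less_le)
      then obtain \<eta> where \<eta>: "\<eta> > 0" "\<forall>u. t - \<eta> < u \<and> u < t \<and> a \<le> u \<longrightarrow> h t - h u \<le> \<epsilon> * (t - u)"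
        using N0(1)[of t] t \<epsilon> by auto
      have "H t \<le> H u" if u: "t - \<eta> < u" "u < t" "a \<le> u" for u
      proof -
        have "h t - h u \<le> \<epsilon> * (t - u)" using \<eta>(2) u by blast
        moreover have "\<psi> u \<le> \<psi> t" using \<psi>_mono u t by simp
        ultimately show ?thesis unfolding H_def by (simp add: algebra_simps)
      qed
      then show ?thesis using \<eta>(1) by blast
    qed
    \<comment> \<open>Real induction: the infimum of this set belongs to it, and by
      \<open>left\<close> it cannot lie to the right of \<open>a\<close>.\<close>
    define S where "S = {u \<in> {a..b}. H b \<le> H u}"
    define s where "s = Inf S"
    have bS: "b \<in> S" using \<open>a \<le> b\<close> by (simp add: S_def)
    have bddS: "bdd_below S" by (rule bdd_belowI[of _ a]) (auto simp: S_def)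
    have s_le: "s \<le> b" unfolding s_def using bS bddS by (intro cInf_lower)
    have s_ge: "a \<le> s" unfolding s_def using bS by (intro cInf_greatest) (auto simp: S_def)
    have s_in: "s \<in> S"
    proof (rule ccontr)
      assume "s \<notin> S"
      then have gap: "H b - H s > 0" using s_le s_ge by (auto simp: S_def)
      \<comment> \<open>Continuity is available only for the part of \<open>H\<close> without
        \<psi>. For \<psi> monotonicity suffices, since the points of \<open>S\<close> approach
        \<open>s\<close> from the right.\<close>
      have "continuous_on {a..b} (\<lambda>t. h t - \<epsilon> * t)"
        by (intro continuous_intros abs_cont_on_imp_continuous_on ac)
      then obtain \<eta> where \<eta>: "\<eta> > 0" "\<And>u. u \<in> {a..b} \<Longrightarrow> dist u s < \<eta> \<Longrightarrow>
          dist (h u - \<epsilon> * u) (h s - \<epsilon> * s) < H b - H s"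
        using s_le s_ge gap unfolding continuous_on_iff by (meson atLeastAtMost_iff)
      obtain u where u: "u \<in> S" "u < s + \<eta>"
        using cInf_lessD[of S "s + \<eta>"] bS \<eta>(1) unfolding s_def by auto
      have su: "s \<le> u" unfolding s_def using u bddS by (intro cInf_lower)
      have "dist (h u - \<epsilon> * u) (h s - \<epsilon> * s) < H b - H s"
        using u su by (intro \<eta>) (auto simp: S_def dist_real_def)
      moreover have "\<psi> s \<le> \<psi> u" using \<psi>_mono su u by (auto simp: S_def)
      ultimately have "H u < H b" unfolding H_def dist_real_def by linarith
      then show False using u by (auto simp: S_def)
    qed
    have "s = a"
    proof (rule ccontr)
      assume "s \<noteq> a"
      then have "a < s" using s_ge by simp
      then obtain \<eta> where \<eta>: "\<eta> > 0" "\<forall>u. s - \<eta> < u \<and> u < s \<and> a \<le> u \<longrightarrow> H s \<le> H u"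
        using left s_le by blast
      define u where "u = max a (s - \<eta> / 2)"
      have u: "a \<le> u" "u < s" "s - \<eta> < u" using \<eta> \<open>a < s\<close> by (auto simp: u_def)
      then have "H s \<le> H u" using \<eta> by blast
      then have "u \<in> S" using s_in u s_le by (auto simp: S_def)
      then have "s \<le> u" unfolding s_def using bddS by (intro cInf_lower)
      then show False using u by simp
    qed
    then have "H b \<le> H a" using s_in by (simp add: S_def)
    then have "h b - h a \<le> \<epsilon> * b - \<epsilon> * a + \<psi> b - \<psi> a" unfolding H_def by linarith
    moreover have "\<psi> b \<le> \<epsilon>" "0 \<le> \<psi> a" using \<psi>_le \<psi>_nonneg \<open>a \<le> b\<close> by auto
    ultimately show ?thesis by (simp add: right_diff_distrib)
  qed
  have "h b - h a \<le> 0 + e" if "e > 0" for e :: real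
  proof -
    \<comment> \<open>Chosen so that the error in \<open>key\<close> equals \<open>e\<close>; the
      summand 1 in the denominator comes from the additive \<epsilon> there and covers
      \<open>a = b\<close>.\<close>
    define \<epsilon> where "\<epsilon> = e / (b - a + 1)"
    have "\<epsilon> > 0" using that \<open>a \<le> b\<close> by (simp add: \<epsilon>_def)
    then have "h b - h a \<le> \<epsilon> * (b - a) + \<epsilon>" by (rule key)
    also have "\<dots> = \<epsilon> * (b - a + 1)" by (simp add: algebra_simps)
    also have "\<dots> = e" using \<open>a \<le> b\<close> by (simp add: \<epsilon>_def)
    finally show ?thesis by simp
  qed
  then have "h b - h a \<le> 0" by (rule field_le_epsilon)
  then show ?thesis by simp
qed

section \<open>Lagrange multipliers and graph Laplacians\<close>

text \<open>Induction on the number of constraints. Restricting to the zero set of the last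
  constraint yields the other multipliers; the last one is a number separating the slopes
  \<open>\<Psi> / c m\<close> on its two sides. The fourth hypothesis stands for Slater's condition:
  every vector of constraint values can be reversed up to a positive factor. The combination map
  \<open>C\<close> is abstract so that single vectors and global vectors are both covered.\<close>

lemma affine_multipliers:
  fixes C :: "real \<Rightarrow> 'v \<Rightarrow> 'v \<Rightarrow> 'v" and c :: "nat \<Rightarrow> 'v \<Rightarrow> real" and \<Phi> :: "'v \<Rightarrow> real"
  assumes "\<And>u v \<theta>. u \<in> K \<Longrightarrow> v \<in> K \<Longrightarrow> 0 \<le> \<theta> \<Longrightarrow> \<theta> \<le> 1 \<Longrightarrow> C \<theta> u v \<in> K"
    and "\<And>u v \<theta>. u \<in> K \<Longrightarrow> v \<in> K \<Longrightarrow> 0 \<le> \<theta> \<Longrightarrow> \<theta> \<le> 1 \<Longrightarrow> \<Phi> (C \<theta> u v) \<le> (1 - \<theta>) * \<Phi> u + \<theta> * \<Phi> v"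
    and "\<And>r u v \<theta>. r < m \<Longrightarrow> u \<in> K \<Longrightarrow> v \<in> K \<Longrightarrow> 0 \<le> \<theta> \<Longrightarrow> \<theta> \<le> 1 \<Longrightarrow> c r (C \<theta> u v) = (1 - \<theta>) * c r u + \<theta> * c r v"
    and "\<And>y. y \<in> K \<Longrightarrow> \<exists>y'\<in>K. \<exists>s>0. \<forall>r<m. c r y' = - s * c r y"
    and "\<And>y. y \<in> K \<Longrightarrow> \<forall>r<m. c r y = 0 \<Longrightarrow> 0 \<le> \<Phi> y"
  shows "\<exists>\<mu>. \<forall>y\<in>K. (\<Sum>r<m. \<mu> r * c r y) \<le> \<Phi> y"
  using assms
proof (induction m arbitrary: K)
  case 0
  then show ?case by auto
next
  case (Suc m)
  note K = Suc.prems(1) and cvx = Suc.prems(2) and aff = Suc.prems(3)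
    and reflect = Suc.prems(4) and opt = Suc.prems(5)
  define K' where "K' = {y \<in> K. c m y = 0}"
  have "\<exists>\<mu>. \<forall>y\<in>K'. (\<Sum>r<m. \<mu> r * c r y) \<le> \<Phi> y"
  proof (rule Suc.IH)
    \<comment> \<open>Reversal does not leave \<open>K'\<close>, since \<open>c m y = 0\<close>
      implies \<open>c m y' = 0\<close>.\<close>
    show "\<exists>y'\<in>K'. \<exists>s>0. \<forall>r<m. c r y' = - s * c r y" if yK: "y \<in> K'" for y
    proof -
      obtain y' s where "y' \<in> K" "s > 0" "\<forall>r<Suc m. c r y' = - s * c r y"
        using reflect[of y] yK unfolding K'_def by blast
      then show ?thesis using yK unfolding K'_def by (auto intro!: bexI[of _ y'] exI[of _ s])
    qed
    show "0 \<le> \<Phi> y" if "y \<in> K'" "\<forall>r<m. c r y = 0" for y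
      using that opt[of y] by (auto simp: K'_def less_Suc_eq)
  qed (auto simp: K'_def K cvx aff)
  then obtain \<mu> where \<mu>: "\<forall>y\<in>K'. (\<Sum>r<m. \<mu> r * c r y) \<le> \<Phi> y" by blast
  define \<Psi> where "\<Psi> y = \<Phi> y - (\<Sum>r<m. \<mu> r * c r y)" for y
  have \<Psi>0: "0 \<le> \<Psi> y" if "y \<in> K" "c m y = 0" for y
    using \<mu> that by (auto simp: \<Psi>_def K'_def)
  have \<Psi>_cvx: "\<Psi> (C \<theta> u v) \<le> (1 - \<theta>) * \<Psi> u + \<theta> * \<Psi> v" if "u \<in> K" "v \<in> K" "0 \<le> \<theta>" "\<theta> \<le> 1" for u v \<theta>
  proof -
    have "(\<Sum>r<m. \<mu> r * c r (C \<theta> u v)) = (\<Sum>r<m. (1 - \<theta>) * (\<mu> r * c r u) + \<theta> * (\<mu> r * c r v))"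
    proof (intro sum.cong refl)
      fix r assume "r \<in> {..<m}"
      then show "\<mu> r * c r (C \<theta> u v) = (1 - \<theta>) * (\<mu> r * c r u) + \<theta> * (\<mu> r * c r v)"
        by (subst aff[OF _ that]) (auto simp: algebra_simps)
    qed
    also have "\<dots> = (1 - \<theta>) * (\<Sum>r<m. \<mu> r * c r u) + \<theta> * (\<Sum>r<m. \<mu> r * c r v)"
      by (simp add: sum.distrib sum_distrib_left)
    finally show ?thesis
      using cvx[OF that] unfolding \<Psi>_def by (simp add: algebra_simps)
  qed
  have cross: "\<Psi> v / c m v \<le> \<Psi> u / c m u" if uv: "u \<in> K" "v \<in> K" "c m u > 0" "c m v < 0" for u v
  proof -
    \<comment> \<open>The weight at which the affine function \<open>c m\<close> vanishes between
      \<open>u\<close> and \<open>v\<close>; there \<open>\<Psi>0\<close> applies, and convexity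
      turns it into the comparison of slopes.\<close>
    define \<theta> where "\<theta> = c m u / (c m u - c m v)"
    have pos: "c m u - c m v > 0" using uv by simp
    have \<theta>: "0 \<le> \<theta>" "\<theta> \<le> 1" using uv pos by (auto simp: \<theta>_def field_simps)
    have \<theta>1: "1 - \<theta> = - c m v / (c m u - c m v)" using pos by (simp add: \<theta>_def field_simps)
    have "c m (C \<theta> u v) = 0"
      using aff[of m u v \<theta>] uv \<theta> unfolding \<theta>1 by (simp add: \<theta>_def)
    then have "0 \<le> (1 - \<theta>) * \<Psi> u + \<theta> * \<Psi> v"
      using \<Psi>0[OF K[OF uv(1,2) \<theta>]] \<Psi>_cvx[OF uv(1,2) \<theta>] by linarith
    also have "\<dots> = (\<Psi> v * c m u - \<Psi> u * c m v) / (c m u - c m v)"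
      unfolding \<theta>1 by (simp add: \<theta>_def add_divide_distrib diff_divide_distrib mult.commute)
    finally have "0 \<le> \<Psi> v * c m u - \<Psi> u * c m v" using pos by (simp add: zero_le_divide_iff)
    then show ?thesis using uv by (simp add: field_simps)
  qed
  have "\<exists>\<tau>. \<forall>y\<in>K. \<tau> * c m y \<le> \<Psi> y"
  proof (cases "\<forall>y\<in>K. c m y = 0")
    case True
    then show ?thesis using \<Psi>0 by (intro exI[of _ 0]) auto
  next
    case False
    then obtain y0 where y0: "y0 \<in> K" "c m y0 \<noteq> 0" by blast
    obtain y1 s where y1: "y1 \<in> K" "s > 0" "c m y1 = - s * c m y0"
      using reflect[OF y0(1)] by blast
    \<comment> \<open>The point \<open>y0\<close> and its reversal \<open>y1\<close> lie on opposite
      sides of the last constraint.\<close>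
    have "\<exists>u\<in>K. \<exists>v\<in>K. c m u > 0 \<and> c m v < 0"
    proof (cases "c m y0 > 0")
      case True
      then have "c m y1 < 0" using y1 by simp
      then show ?thesis using True y0 y1 by blast
    next
      case False
      then have "c m y0 < 0" using y0 by simp
      then have "c m y1 > 0" using y1 by (simp add: mult_less_0_iff)
      then show ?thesis using \<open>c m y0 < 0\<close> y0 y1 by blast
    qed
    then obtain u0 v0 where uv0: "u0 \<in> K" "v0 \<in> K" "c m u0 > 0" "c m v0 < 0" by blast
    \<comment> \<open>By \<open>cross\<close>, no slope on the negative side exceeds a slope on the
      positive side, so this supremum lies between the two families.\<close>
    define \<tau> where "\<tau> = Sup ((\<lambda>v. \<Psi> v / c m v) ` {v \<in> K. c m v < 0})"
    have bdd: "bdd_above ((\<lambda>v. \<Psi> v / c m v) ` {v \<in> K. c m v < 0})"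
      using cross[OF uv0(1) _ uv0(3)] by (intro bdd_aboveI[of _ "\<Psi> u0 / c m u0"]) auto
    have "\<tau> * c m y \<le> \<Psi> y" if y: "y \<in> K" for y
    proof (cases "c m y" "0::real" rule: linorder_cases)
      case less
      then have "\<Psi> y / c m y \<le> \<tau>" unfolding \<tau>_def using y by (intro cSup_upper bdd) auto
      then show ?thesis using less by (simp add: neg_divide_le_eq)
    next
      case equal
      then show ?thesis using \<Psi>0 y by simp
    next
      case greater
      then have "\<tau> \<le> \<Psi> y / c m y"
        unfolding \<tau>_def using cross[OF y] uv0 by (intro cSup_least) auto
      then show ?thesis using greater by (simp add: pos_le_divide_eq)
    qed
    then show ?thesis by blast
  qed
  then obtain \<tau> where \<tau>: "\<forall>y\<in>K. \<tau> * c m y \<le> \<Psi> y" by blast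
  have "(\<Sum>r<Suc m. (\<mu>(m := \<tau>)) r * c r y) \<le> \<Phi> y" if "y \<in> K" for y
    using \<tau> that unfolding \<Psi>_def by (auto simp: le_diff_eq add.commute)
  then show ?case by blast
qed

section \<open>Quadratic form, kernel and range of the graph Laplacian\<close>

text \<open>Summation by parts: exchanging the two indices and using the symmetry of the weights
  turns the factor \<open>y i\<close> into \<open>- y j\<close>; the average of both forms is the
  symmetric bilinear form.\<close>

lemma sum_mult_laplacian:
  fixes a :: "nat \<Rightarrow> nat \<Rightarrow> real"
  assumes "\<And>i j. i < n \<Longrightarrow> j < n \<Longrightarrow> a i j = a j i"
  shows "(\<Sum>i<n. y i * (\<Sum>j<n. a i j * (v i - v j))) = (\<Sum>i<n. \<Sum>j<n. a i j * ((y i - y j) * (v i - v j))) / 2"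
proof -
  have eq: "(\<Sum>i<n. y i * (\<Sum>j<n. a i j * (v i - v j))) = (\<Sum>i<n. \<Sum>j<n. a i j * (y i * (v i - v j)))"
    by (simp add: sum_distrib_left mult.left_commute)
  also have "\<dots> = (\<Sum>j<n. \<Sum>i<n. a i j * (y i * (v i - v j)))" by (rule sum.swap)
  also have "\<dots> = (\<Sum>i<n. \<Sum>j<n. a i j * (- y j * (v i - v j)))"
    using assms by (intro sum.cong refl) (auto simp: algebra_simps)
  finally have eq': "(\<Sum>i<n. y i * (\<Sum>j<n. a i j * (v i - v j))) = (\<Sum>i<n. \<Sum>j<n. a i j * (- y j * (v i - v j)))" .
  have "2 * (\<Sum>i<n. y i * (\<Sum>j<n. a i j * (v i - v j))) =
      (\<Sum>i<n. \<Sum>j<n. a i j * (y i * (v i - v j))) + (\<Sum>i<n. \<Sum>j<n. a i j * (- y j * (v i - v j)))"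
    using eq eq' by linarith
  also have "\<dots> = (\<Sum>i<n. \<Sum>j<n. a i j * ((y i - y j) * (v i - v j)))"
    by (simp add: sum.distrib[symmetric] algebra_simps)
  finally show ?thesis by simp
qed

text \<open>The quadratic form of \<open>y\<close> vanishes and its terms are nonnegative, so each
  term is zero. Hence \<open>y\<close> agrees across every edge, and along every path.\<close>

lemma laplacian_eq_0_imp_const:
  assumes g: "weighted_graph n a" "graph_connected n a"
    and L: "\<forall>i<n. (\<Sum>j<n. a i j * (y i - y j)) = 0" and ij: "i < n" "j < n"
  shows "y i = y j"
proof -
  have nonneg: "0 \<le> a i j * ((y i - y j) * (y i - y j))" if "i < n" "j < n" for i j
    using g(1) that unfolding weighted_graph_def by simp
  have total: "(\<Sum>i<n. \<Sum>j<n. a i j * ((y i - y j) * (y i - y j))) = 0"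
    using sum_mult_laplacian[of n a y y] g(1) L unfolding weighted_graph_def by simp
  have zero: "a i j * ((y i - y j) * (y i - y j)) = 0" if ij: "i < n" "j < n" for i j
  proof -
    have "\<forall>i\<in>{..<n}. (\<Sum>j<n. a i j * ((y i - y j) * (y i - y j))) = 0"
      using total by (subst sum_nonneg_eq_0_iff[symmetric]) (auto intro!: sum_nonneg nonneg)
    then have "(\<Sum>j<n. a i j * ((y i - y j) * (y i - y j))) = 0" using ij(1) by simp
    then have "\<forall>j\<in>{..<n}. a i j * ((y i - y j) * (y i - y j)) = 0"
      using ij(1) by (subst sum_nonneg_eq_0_iff[symmetric]) (auto intro!: nonneg)
    then show ?thesis using ij(2) by simp
  qed
  have "(i, j) \<in> {(u, v). u < n \<and> v < n \<and> a u v > 0}\<^sup>*"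
    using g(2) ij unfolding graph_connected_def by blast
  then show ?thesis
  proof (induction rule: rtrancl_induct)
    case (step u v)
    then show ?case using zero[of u v] by auto
  qed simp
qed

text \<open>The solution is a multiplier. On the kernel of the Laplacian, which consists of
  constants, the functional given by \<open>b\<close> vanishes; so some \<open>v\<close> satisfies
  an inequality between \<open>v\<close> applied to the Laplacian of \<open>y\<close> and
  \<open>b\<close> applied to \<open>y\<close>, and symmetry moves the Laplacian onto
  \<open>v\<close>.\<close>

lemma laplacian_solvable:
  fixes b :: "nat \<Rightarrow> real"
  assumes g: "weighted_graph n a" "graph_connected n a" and b: "(\<Sum>i<n. b i) = 0"
  shows "\<exists>v. \<forall>i<n. (\<Sum>j<n. a i j * (v i - v j)) = b i"
proof -
  define c where "c i y = (\<Sum>j<n. a i j * (y i - y j))" for i and y :: "nat \<Rightarrow> real"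
  have "\<exists>\<mu>. \<forall>y\<in>UNIV. (\<Sum>r<n. \<mu> r * c r y) \<le> (\<Sum>i<n. b i * y i)"
  proof (rule affine_multipliers[where C = comb])
    fix u v \<theta>
    show "(\<Sum>i<n. b i * comb \<theta> u v i) \<le> (1 - \<theta>) * (\<Sum>i<n. b i * u i) + \<theta> * (\<Sum>i<n. b i * v i)"
      by (simp add: comb_def sum_distrib_left sum.distrib[symmetric] algebra_simps)
    show "c r (comb \<theta> u v) = (1 - \<theta>) * c r u + \<theta> * c r v" for r
      by (simp add: c_def comb_def sum_distrib_left sum.distrib[symmetric] algebra_simps)
  next
    fix y
    have "c r (\<lambda>i. - y i) = - 1 * c r y" for r
      by (simp add: c_def sum_negf[symmetric] algebra_simps)
    then show "\<exists>y'\<in>UNIV. \<exists>s>0. \<forall>r<n. c r y' = - s * c r y"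
      by (intro bexI[of _ "\<lambda>i. - y i"] exI[of _ 1]) auto
    show "0 \<le> (\<Sum>i<n. b i * y i)" if "\<forall>r<n. c r y = 0"
    proof -
      have "y i = y 0" if "i < n" for i
        using laplacian_eq_0_imp_const[OF g, of y i 0] that \<open>\<forall>r<n. c r y = 0\<close> by (auto simp: c_def)
      then have "(\<Sum>i<n. b i * y i) = (\<Sum>i<n. b i * y 0)" by (intro sum.cong) (simp, metis lessThan_iff)
      also have "\<dots> = (\<Sum>i<n. b i) * y 0" by (simp add: sum_distrib_right)
      finally show ?thesis using b by simp
    qed
  qed auto
  then obtain v where v: "\<And>y. (\<Sum>r<n. v r * c r y) \<le> (\<Sum>i<n. b i * y i)" by blast
  have sym: "(\<Sum>r<n. v r * c r y) = (\<Sum>r<n. y r * c r v)" for y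
    unfolding c_def using g(1) by (subst (1 2) sum_mult_laplacian) (auto simp: weighted_graph_def mult.commute)
  \<comment> \<open>Testing with the unit vector and with its negative turns the inequality into an
    equation.\<close>
  have "c i v = b i" if i: "i < n" for i
  proof -
    have "(\<Sum>r<n. (if r = i then e else 0) * c r v) = e * c i v"
      "(\<Sum>r<n. b r * (if r = i then e else 0)) = b i * e" for e
      using i by (simp_all add: if_distrib[of "\<lambda>x. x * _"] if_distrib[of "\<lambda>x. _ * x"] cong: if_cong)
    then have "e * c i v \<le> b i * e" for e using v[of "\<lambda>r. if r = i then e else 0"] sym by simp
    from this[of 1] this[of "-1"] show ?thesis by simp
  qed
  then show ?thesis unfolding c_def by blast
qed

section \<open>Projections and convex functions on coordinate spaces\<close>

lemma nrm_nonneg: "0 \<le> nrm q v"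
  by (simp add: nrm_def ip_def sum_nonneg)

lemma nrm_power2: "(nrm q v)\<^sup>2 = ip q v v"
  by (simp add: nrm_def ip_def sum_nonneg)

lemma nrm_eq_L2_set: "nrm q v = L2_set v {..<q}"
  by (simp add: nrm_def ip_def L2_set_def power2_eq_square)

lemma nrm_le_sum_abs: "nrm q v \<le> (\<Sum>k<q. \<bar>v k\<bar>)"
  by (simp add: nrm_eq_L2_set L2_set_le_sum_abs)

lemma abs_le_nrm: "k < q \<Longrightarrow> \<bar>v k\<bar> \<le> nrm q v"
  using member_le_L2_set[of "{..<q}" k "\<lambda>k. \<bar>v k\<bar>"] by (simp add: nrm_eq_L2_set L2_set_def)

lemma tendsto_nrm:
  assumes "\<And>k. k < q \<Longrightarrow> ((\<lambda>j. w j k) \<longlongrightarrow> p k) F"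
  shows "((\<lambda>j. nrm q (w j)) \<longlongrightarrow> nrm q p) F"
  unfolding nrm_def ip_def by (intro tendsto_intros assms) auto

text \<open>Cubes are the neighbourhoods used for convex functions, since they can be treated one
  coordinate at a time. The bound \<open>e / (q + 1)\<close> keeps the sum of absolute coordinates
  strictly below \<open>e\<close>, also for \<open>q = 0\<close>.\<close>

lemma nrm_ball_contains_cube:
  assumes "e > 0"
  shows "\<exists>c>0. \<forall>v. (\<forall>k<q. \<bar>v k\<bar> \<le> c) \<longrightarrow> nrm q v < e"
proof (intro exI[of _ "e / (real q + 1)"] conjI allI impI)
  fix v :: "nat \<Rightarrow> real" assume v: "\<forall>k<q. \<bar>v k\<bar> \<le> e / (real q + 1)"
  have "nrm q v \<le> (\<Sum>k<q. \<bar>v k\<bar>)" by (rule nrm_le_sum_abs)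
  also have "\<dots> \<le> (\<Sum>k<q. e / (real q + 1))" using v by (intro sum_mono) auto
  also have "\<dots> = real q / (real q + 1) * e" by simp
  also have "\<dots> < 1 * e" using assms by (intro mult_strict_right_mono) auto
  finally show "nrm q v < e" by simp
qed (use assms in auto)

lemma open_Rn_cube:
  assumes "open_Rn q U" "u \<in> U"
  shows "\<exists>c>0. \<forall>v\<in>Rn q. (\<forall>k<q. \<bar>v k - u k\<bar> \<le> c) \<longrightarrow> v \<in> U"
proof -
  obtain e where e: "e > 0" "\<forall>v\<in>Rn q. nrm q (\<lambda>k. v k - u k) < e \<longrightarrow> v \<in> U"
    using assms unfolding open_Rn_def by blast
  obtain c where c: "c > 0" "\<forall>v. (\<forall>k<q. \<bar>v k\<bar> \<le> c) \<longrightarrow> nrm q v < e"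
    using nrm_ball_contains_cube[OF e(1)] by blast
  have "v \<in> U" if "v \<in> Rn q" "\<forall>k<q. \<bar>v k - u k\<bar> \<le> c" for v
    using e(2) c(2)[rule_format, of "\<lambda>k. v k - u k"] that by blast
  then show ?thesis using c(1) by blast
qed

lemma closed_Rn_limit:
  assumes S: "closed_Rn q S" and w: "\<And>j. w j \<in> S" and p: "p \<in> Rn q"
    and lim: "\<And>k. k < q \<Longrightarrow> (\<lambda>j::nat. w j k) \<longlonglongrightarrow> p k"
  shows "p \<in> S"
proof (rule ccontr)
  assume "p \<notin> S"
  then have "p \<in> Rn q - S" using p by simp
  then obtain e where e: "e > 0" "\<forall>v\<in>Rn q. nrm q (\<lambda>k. v k - p k) < e \<longrightarrow> v \<in> Rn q - S"
    using S unfolding closed_Rn_def open_Rn_def by blast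
  have "(\<lambda>j. nrm q (\<lambda>k. w j k - p k)) \<longlonglongrightarrow> nrm q (\<lambda>k. p k - p k)"
    by (intro tendsto_nrm tendsto_intros lim)
  moreover have "nrm q (\<lambda>k. p k - p k) = 0" by (simp add: nrm_def ip_def)
  ultimately have "\<forall>\<^sub>F j in sequentially. nrm q (\<lambda>k. w j k - p k) < e"
    using e(1) by (intro order_tendstoD(2)[where y = 0]) auto
  then obtain j where "nrm q (\<lambda>k. w j k - p k) < e" unfolding eventually_sequentially by blast
  moreover have "w j \<in> Rn q" using S w unfolding closed_Rn_def by blast
  ultimately show False using e(2) w by blast
qed

text \<open>Bolzano-Weierstrass applied to one index after another, each time refining the previous
  subsequence. The index type is free: it is used for coordinates and for pairs of agent and
  coordinate.\<close>

lemma bounded_coords_convergent_subseq: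
  fixes w :: "nat \<Rightarrow> 'i \<Rightarrow> real"
  assumes "finite I" "\<And>j i. i \<in> I \<Longrightarrow> \<bar>w j i\<bar> \<le> B i"
  shows "\<exists>r p. strict_mono (r :: nat \<Rightarrow> nat) \<and> (\<forall>i\<in>I. (\<lambda>j. w (r j) i) \<longlonglongrightarrow> p i)"
  using assms
proof (induction I rule: finite_induct)
  case empty
  then show ?case by (intro exI[of _ id]) (auto simp: strict_mono_def)
next
  case (insert i I)
  then obtain r p where r: "strict_mono (r :: nat \<Rightarrow> nat)" "\<forall>i\<in>I. (\<lambda>j. w (r j) i) \<longlonglongrightarrow> p i"
    by (meson insertI2)
  have "bounded (range (\<lambda>j. w (r j) i))"
    using insert.prems unfolding bounded_iff by (auto intro!: exI[of _ "B i"])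
  then obtain l s where s: "strict_mono (s :: nat \<Rightarrow> nat)" "((\<lambda>j. w (r j) i) \<circ> s) \<longlonglongrightarrow> l"
    using bounded_imp_convergent_subsequence by blast
  have "(\<lambda>j. w ((r \<circ> s) j) i') \<longlonglongrightarrow> (p(i := l)) i'" if "i' \<in> insert i I" for i'
  proof (cases "i' = i")
    case True
    then show ?thesis using s(2) by (simp add: o_def)
  next
    case False
    then have "(\<lambda>j. w (r j) i') \<longlonglongrightarrow> p i'" using r(2) that by auto
    from LIMSEQ_subseq_LIMSEQ[OF this s(1)] show ?thesis using False by (simp add: o_def)
  qed
  then show ?case using strict_mono_o[OF r(1) s(1)] by blast
qed

section \<open>Projection onto a closed convex set\<close>

text \<open>A minimizing sequence is bounded in every coordinate; the limit of a subsequence lies in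
  \<open>S\<close> by closedness and attains the infimum of the distances.\<close>

lemma nearest_point_exists:
  assumes S: "closed_Rn q S" "S \<noteq> {}"
  shows "\<exists>p\<in>S. \<forall>w\<in>S. nrm q (\<lambda>k. y k - p k) \<le> nrm q (\<lambda>k. y k - w k)"
proof -
  define D where "D = (\<lambda>w. nrm q (\<lambda>k. y k - w k)) ` S"
  have D: "D \<noteq> {}" "bdd_below D"
    using S(2) nrm_nonneg by (auto simp: D_def intro!: bdd_belowI[of _ 0])
  have "\<exists>w\<in>S. nrm q (\<lambda>k. y k - w k) < Inf D + 1 / real (Suc j)" for j
    using cInf_lessD[OF D(1), of "Inf D + 1 / real (Suc j)"] by (auto simp: D_def)
  then obtain w where w: "\<And>j. w j \<in> S" "\<And>j. nrm q (\<lambda>k. y k - w j k) < Inf D + 1 / real (Suc j)"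
    by metis
  have bd: "\<bar>w j k\<bar> \<le> Inf D + 1 + \<bar>y k\<bar>" if "k \<in> {..<q}" for j k
  proof -
    have "\<bar>y k - w j k\<bar> \<le> nrm q (\<lambda>k. y k - w j k)" using abs_le_nrm that by auto
    also have "\<dots> \<le> Inf D + 1" using w(2)[of j] by (smt (verit) divide_le_eq_1_pos of_nat_0_less_iff of_nat_Suc of_nat_0_le_iff zero_less_Suc)
    finally show ?thesis by linarith
  qed
  obtain r p where r: "strict_mono (r :: nat \<Rightarrow> nat)" "\<forall>k\<in>{..<q}. (\<lambda>j. w (r j) k) \<longlonglongrightarrow> p k"
    using bounded_coords_convergent_subseq[of "{..<q}" w "\<lambda>k. Inf D + 1 + \<bar>y k\<bar>"] bd by blast
  \<comment> \<open>The limits are known only for coordinates below \<open>q\<close>; beyond them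
    the value 0 is what membership in \<open>Rn q\<close> demands.\<close>
  define p' where "p' k = (if k < q then p k else 0)" for k
  have lim: "(\<lambda>j. w (r j) k) \<longlonglongrightarrow> p' k" if "k < q" for k
    using r(2) that by (simp add: p'_def)
  have p': "p' \<in> S"
    by (rule closed_Rn_limit[OF S(1), of "\<lambda>j. w (r j)"]) (use w lim in \<open>auto simp: Rn_def p'_def\<close>)
  have "nrm q (\<lambda>k. y k - p' k) \<le> Inf D + 0"
  proof (rule LIMSEQ_le)
    show "(\<lambda>j. nrm q (\<lambda>k. y k - w (r j) k)) \<longlonglongrightarrow> nrm q (\<lambda>k. y k - p' k)"
      by (intro tendsto_nrm tendsto_intros lim)
    have "(\<lambda>j. 1 / real (Suc j)) \<longlonglongrightarrow> 0"
      using LIMSEQ_inverse_real_of_nat by (simp add: inverse_eq_divide)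
    from LIMSEQ_subseq_LIMSEQ[OF this r(1)]
    show "(\<lambda>j. Inf D + 1 / real (Suc (r j))) \<longlonglongrightarrow> Inf D + 0"
      by (intro tendsto_intros) (simp add: o_def)
    show "\<exists>N. \<forall>j\<ge>N. nrm q (\<lambda>k. y k - w (r j) k) \<le> Inf D + 1 / real (Suc (r j))"
      using w(2) less_imp_le by blast
  qed
  moreover have "Inf D \<le> nrm q (\<lambda>k. y k - v k)" if "v \<in> S" for v
    using that D by (intro cInf_lower) (auto simp: D_def)
  ultimately show ?thesis using p' by force
qed

text \<open>Moving from \<open>p\<close> towards \<open>w\<close> by a fraction \<theta> cannot
  decrease the distance to \<open>y\<close>. Expanding the square and dividing by \<theta> bounds
  twice the inner product by \<open>\<theta> * N\<close>, which is impossible for small \<theta> if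
  the inner product is positive.\<close>

lemma nearest_point_variational:
  assumes S: "cvx_set S" and p: "p \<in> S" and w: "w \<in> S"
    and nearest: "\<forall>w\<in>S. nrm q (\<lambda>k. y k - p k) \<le> nrm q (\<lambda>k. y k - w k)"
  shows "ip q (\<lambda>k. y k - p k) (\<lambda>k. w k - p k) \<le> 0"
proof (rule ccontr)
  define I where "I = ip q (\<lambda>k. y k - p k) (\<lambda>k. w k - p k)"
  define N where "N = ip q (\<lambda>k. w k - p k) (\<lambda>k. w k - p k)"
  assume "\<not> ?thesis"
  then have I: "I > 0" by (simp add: I_def)
  have N: "N \<ge> 0" by (simp add: N_def ip_def sum_nonneg)
  have le: "2 * I \<le> \<theta> * N" if \<theta>: "0 < \<theta>" "\<theta> \<le> 1" for \<theta>
  proof -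
    have "comb \<theta> p w \<in> S" using S p w \<theta> unfolding cvx_set_def by auto
    then have "nrm q (\<lambda>k. y k - p k) \<le> nrm q (\<lambda>k. y k - comb \<theta> p w k)" using nearest by blast
    then have "(nrm q (\<lambda>k. y k - p k))\<^sup>2 \<le> (nrm q (\<lambda>k. y k - comb \<theta> p w k))\<^sup>2"
      by (intro power_mono nrm_nonneg)
    also have "\<dots> = (nrm q (\<lambda>k. y k - p k))\<^sup>2 - 2 * \<theta> * I + \<theta> * \<theta> * N"
      unfolding nrm_power2 I_def N_def ip_def comb_def
      by (simp add: sum_distrib_left sum.distrib[symmetric] sum_subtractf[symmetric] algebra_simps)
    finally have "\<theta> * (2 * I) \<le> \<theta> * (\<theta> * N)" by (simp add: algebra_simps)
    then show ?thesis using \<theta> by simp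
  qed
  \<comment> \<open>This makes \<open>\<theta> * N\<close> at most \<open>I\<close>, against the
    lower bound \<open>2 * I\<close>; the summand 1 covers \<open>N = 0\<close>.\<close>
  define \<theta> where "\<theta> = min 1 (I / (N + 1))"
  have "2 * I \<le> \<theta> * N" using I N by (intro le) (auto simp: \<theta>_def)
  also have "\<dots> \<le> I / (N + 1) * N" using N by (intro mult_right_mono) (auto simp: \<theta>_def)
  also have "\<dots> \<le> I / (N + 1) * (N + 1)" using I N by (intro mult_left_mono) auto
  also have "\<dots> = I" using N by simp
  finally show False using I by simp
qed

text \<open>The description in \<open>proj\<close> denotes: a nearest point exists, and expanding
  the squared distance around it, its variational inequality forces any second nearest point to
  coincide with it.\<close>

lemma proj_variational:
  assumes S: "closed_Rn q S" "cvx_set S" "S \<noteq> {}"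
  shows "proj q S y \<in> S"
    and "w \<in> S \<Longrightarrow> ip q (\<lambda>k. y k - proj q S y k) (\<lambda>k. w k - proj q S y k) \<le> 0"
proof -
  let ?P = "\<lambda>p. p \<in> S \<and> (\<forall>w\<in>S. nrm q (\<lambda>k. y k - p k) \<le> nrm q (\<lambda>k. y k - w k))"
  have ex: "\<exists>p. ?P p" using nearest_point_exists[OF S(1,3)] by blast
  have uniq: "p' = p" if p: "?P p" and p': "?P p'" for p p'
  proof -
    have "nrm q (\<lambda>k. y k - p' k) \<le> nrm q (\<lambda>k. y k - p k)" using p p' by blast
    then have "(nrm q (\<lambda>k. y k - p' k))\<^sup>2 \<le> (nrm q (\<lambda>k. y k - p k))\<^sup>2"
      by (intro power_mono nrm_nonneg)
    moreover have "(nrm q (\<lambda>k. y k - p' k))\<^sup>2 = (nrm q (\<lambda>k. y k - p k))\<^sup>2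
        - 2 * ip q (\<lambda>k. y k - p k) (\<lambda>k. p' k - p k) + (nrm q (\<lambda>k. p' k - p k))\<^sup>2"
      unfolding nrm_power2 ip_def
      by (simp add: sum_distrib_left sum.distrib[symmetric] sum_subtractf[symmetric] algebra_simps)
    moreover have "ip q (\<lambda>k. y k - p k) (\<lambda>k. p' k - p k) \<le> 0"
      using p p' by (intro nearest_point_variational[OF S(2)]) auto
    ultimately have "(nrm q (\<lambda>k. p' k - p k))\<^sup>2 \<le> 0" by linarith
    then have "nrm q (\<lambda>k. p' k - p k) = 0" by simp
    then have "p' k = p k" if "k < q" for k using abs_le_nrm[OF that, of "\<lambda>k. p' k - p k"] by simp
    moreover have "p \<in> Rn q" "p' \<in> Rn q" using p p' S(1) unfolding closed_Rn_def by auto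
    ultimately have "p' k = p k" for k by (cases "k < q") (auto simp: Rn_def)
    then show ?thesis by blast
  qed
  have "\<exists>!p. ?P p" using ex uniq by (rule ex_ex1I)
  from theI'[OF this] have P: "?P (proj q S y)" unfolding proj_def .
  then show "proj q S y \<in> S" by blast
  show "ip q (\<lambda>k. y k - proj q S y k) (\<lambda>k. w k - proj q S y k) \<le> 0" if "w \<in> S"
    using P that by (intro nearest_point_variational[OF S(2)]) auto
qed

section \<open>Local boundedness and Lipschitz continuity of convex functions\<close>

lemma strict_cvx_onD:
  assumes "strict_cvx_on q U h" "u \<in> U" "v \<in> U" "0 \<le> \<theta>" "\<theta> \<le> 1"
  shows "h (comb \<theta> u v) \<le> (1 - \<theta>) * h u + \<theta> * h v"
proof (cases "u = v \<or> \<theta> = 0 \<or> \<theta> = 1")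
  case True
  moreover have "comb \<theta> u u = u" "comb 0 u v = u" "comb 1 u v = v"
    by (auto simp: comb_def algebra_simps)
  ultimately show ?thesis by (auto simp: algebra_simps)
next
  case False
  then show ?thesis using assms unfolding strict_cvx_on_def by (auto intro!: less_imp_le)
qed

text \<open>On a segment a convex function is bounded by its values at the ends, so bounds on two
  opposite faces bound everything between them. Freeing one coordinate after another reaches the
  whole cube.\<close>

lemma cube_bounded_above:
  assumes h: "strict_cvx_on q U h" and c: "c > 0"
    and cube: "\<forall>v\<in>Rn q. (\<forall>k<q. \<bar>v k - u k\<bar> \<le> c) \<longrightarrow> v \<in> U"
  shows "\<exists>M. \<forall>v\<in>Rn q. (\<forall>k<q. \<bar>v k - u k\<bar> \<le> c) \<longrightarrow> h v \<le> M"
proof -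
  define Q where "Q = {v \<in> Rn q. \<forall>k<q. \<bar>v k - u k\<bar> \<le> c}"
  \<comment> \<open>At stage \<open>j\<close> the coordinates from \<open>j\<close> on are frozen at
    those of \<open>v0\<close>. Stage 0 is a single point; at stage \<open>q\<close> only vanishing
    coordinates are frozen.\<close>
  have "\<forall>v0\<in>Q. \<exists>M. \<forall>v\<in>Q. (\<forall>k\<ge>j. v k = v0 k) \<longrightarrow> h v \<le> M" if "j \<le> q" for j
    using that
  proof (induction j)
    case 0
    have "v = v0" if "\<forall>k\<ge>0. v k = v0 k" for v v0 :: "nat \<Rightarrow> real" using that by auto
    then show ?case by (metis order_refl)
  next
    case (Suc j)
    show ?case
    proof
      fix v0 assume v0: "v0 \<in> Q"
      define lo hi where "lo = v0(j := u j - c)" and "hi = v0(j := u j + c)"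
      have Q_upd: "v(j := x) \<in> Q" if "v \<in> Q" "\<bar>x - u j\<bar> \<le> c" for v x
        using that Suc.prems by (auto simp: Q_def Rn_def)
      have Q: "lo \<in> Q" "hi \<in> Q" unfolding lo_def hi_def using v0 c by (auto intro!: Q_upd)
      have IH: "\<forall>v0\<in>Q. \<exists>M. \<forall>v\<in>Q. (\<forall>k\<ge>j. v k = v0 k) \<longrightarrow> h v \<le> M"
        using Suc by simp
      obtain M1 where M1: "\<forall>v\<in>Q. (\<forall>k\<ge>j. v k = lo k) \<longrightarrow> h v \<le> M1"
        using bspec[OF IH Q(1)] by (elim exE)
      obtain M2 where M2: "\<forall>v\<in>Q. (\<forall>k\<ge>j. v k = hi k) \<longrightarrow> h v \<le> M2"
        using bspec[OF IH Q(2)] by (elim exE)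
      have "h v \<le> max M1 M2" if v: "v \<in> Q" "\<forall>k\<ge>Suc j. v k = v0 k" for v
      proof -
        define v1 v2 where "v1 = v(j := u j - c)" and "v2 = v(j := u j + c)"
        have vQ: "v1 \<in> Q" "v2 \<in> Q" unfolding v1_def v2_def using v c by (auto intro!: Q_upd)
        have "h v1 \<le> M1" using M1 vQ(1) v(2) by (auto simp: v1_def lo_def)
        moreover have "h v2 \<le> M2" using M2 vQ(2) v(2) by (auto simp: v2_def hi_def)
        moreover
        \<comment> \<open>The relative position of \<open>v j\<close> between the two faces
          \<open>u j - c\<close> and \<open>u j + c\<close>.\<close>
        define \<theta> where "\<theta> = (v j - u j + c) / (2 * c)"
        have "\<bar>v j - u j\<bar> \<le> c" using v Suc.prems by (auto simp: Q_def)
        then have \<theta>: "0 \<le> \<theta>" "\<theta> \<le> 1" using c by (auto simp: \<theta>_def field_simps)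
        have "comb \<theta> v1 v2 = v"
        proof
          fix k show "comb \<theta> v1 v2 k = v k"
            using c by (cases "k = j") (auto simp: comb_def v1_def v2_def \<theta>_def field_simps)
        qed
        then have "h v \<le> (1 - \<theta>) * h v1 + \<theta> * h v2"
          using strict_cvx_onD[OF h, of v1 v2 \<theta>] vQ \<theta> cube by (auto simp: Q_def)
        ultimately have "h v \<le> (1 - \<theta>) * max M1 M2 + \<theta> * max M1 M2"
          using \<theta> by (smt (verit, best) mult_left_mono)
        then show ?thesis by (simp add: algebra_simps)
      qed
      then show "\<exists>M. \<forall>v\<in>Q. (\<forall>k\<ge>Suc j. v k = v0 k) \<longrightarrow> h v \<le> M" by blast
    qed
  qed
  from this[of q] have all: "\<forall>v0\<in>Q. \<exists>M. \<forall>v\<in>Q. (\<forall>k\<ge>q. v k = v0 k) \<longrightarrow> h v \<le> M" by simp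
  show ?thesis
  proof (cases "Q = {}")
    case True
    then show ?thesis unfolding Q_def by blast
  next
    case False
    then obtain v0 where "v0 \<in> Q" by blast
    from bspec[OF all this] obtain M where M: "\<forall>v\<in>Q. (\<forall>k\<ge>q. v k = v0 k) \<longrightarrow> h v \<le> M"
      by (elim exE)
    have "h v \<le> M" if "v \<in> Q" for v
      using M that \<open>v0 \<in> Q\<close> by (auto simp: Q_def Rn_def)
    then show ?thesis by (auto simp: Q_def)
  qed
qed

text \<open>An upper bound on a cube gives a lower bound by reflection in the centre. If the segment
  from \<open>v\<close> to \<open>w\<close> is prolonged inside the larger cube, convexity bounds
  the slope on it by the oscillation \<open>K\<close> over the room left, which gives the Lipschitz
  constant on the cube of half the size.\<close>

lemma strict_cvx_on_locally_Lipschitz: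
  assumes h: "strict_cvx_on q U h" and U: "open_Rn q U" and u: "u \<in> U"
  shows "\<exists>e>0. \<exists>M. \<forall>v\<in>Rn q. \<forall>w\<in>Rn q. (\<forall>k<q. \<bar>v k - u k\<bar> \<le> e) \<longrightarrow> (\<forall>k<q. \<bar>w k - u k\<bar> \<le> e) \<longrightarrow>
      \<bar>h v - h w\<bar> \<le> M * (\<Sum>k<q. \<bar>v k - w k\<bar>)"
proof -
  obtain c where c: "c > 0" and cube: "\<forall>v\<in>Rn q. (\<forall>k<q. \<bar>v k - u k\<bar> \<le> c) \<longrightarrow> v \<in> U"
    using open_Rn_cube[OF U u] by blast
  obtain M where M: "\<forall>v\<in>Rn q. (\<forall>k<q. \<bar>v k - u k\<bar> \<le> c) \<longrightarrow> h v \<le> M"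
    using cube_bounded_above[OF h c cube] by blast
  have uR: "u \<in> Rn q" using U u unfolding open_Rn_def by blast
  have low: "2 * h u - M \<le> h v" if v: "v \<in> Rn q" "\<forall>k<q. \<bar>v k - u k\<bar> \<le> c" for v
  proof -
    define v' where "v' k = 2 * u k - v k" for k
    have v': "v' \<in> Rn q" "\<forall>k<q. \<bar>v' k - u k\<bar> \<le> c"
      using v uR by (auto simp: v'_def Rn_def abs_minus_commute)
    have "comb (1/2) v v' = u" by (auto simp: comb_def v'_def fun_eq_iff field_simps)
    then have "h u \<le> (1 - 1/2) * h v + 1/2 * h v'"
      using strict_cvx_onD[OF h, of v v' "1/2"] v v' cube by auto
    moreover have "h v' \<le> M" using M v' by blast
    ultimately show ?thesis by (simp add: field_simps)
  qed
  define K where "K = 2 * (M - h u)"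
  have K: "h w - h v \<le> K" if "v \<in> Rn q" "\<forall>k<q. \<bar>v k - u k\<bar> \<le> c" "w \<in> Rn q" "\<forall>k<q. \<bar>w k - u k\<bar> \<le> c" for v w
  proof -
    have "h w \<le> M" using M that by blast
    then show ?thesis using low[OF that(1,2)] by (simp add: K_def)
  qed
  have K0: "K \<ge> 0" using K[of u u] uR c by auto
  have lip: "h w - h v \<le> 2 * K / c * (\<Sum>k<q. \<bar>v k - w k\<bar>)"
    if v: "v \<in> Rn q" "\<forall>k<q. \<bar>v k - u k\<bar> \<le> c / 2" and w: "w \<in> Rn q" "\<forall>k<q. \<bar>w k - u k\<bar> \<le> c / 2" for v w
  proof (cases "v = w")
    case True
    then show ?thesis by simp
  next
    case False
    define s where "s = (\<Sum>k<q. \<bar>v k - w k\<bar>)"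
    have mem: "\<bar>v k - w k\<bar> \<le> s" if "k < q" for k
      unfolding s_def using that by (intro member_le_sum) auto
    have "s > 0"
    proof (rule ccontr)
      assume "\<not> s > 0"
      then have "v k = w k" for k
      proof (cases "k < q")
        case True
        then show ?thesis using mem[OF True] \<open>\<not> s > 0\<close> by linarith
      qed (use v(1) w(1) in \<open>auto simp: Rn_def\<close>)
      then show False using False by auto
    qed
    \<comment> \<open>The point beyond \<open>w\<close> on the ray from \<open>v\<close>: each
      coordinate moves by at most \<open>c / 2\<close>, so \<open>w'\<close> stays in the larger
      cube.\<close>
    define w' where "w' k = w k + c / (2 * s) * (w k - v k)" for k
    have w': "w' \<in> Rn q" using v(1) w(1) by (auto simp: w'_def Rn_def)
    have w'c: "\<forall>k<q. \<bar>w' k - u k\<bar> \<le> c"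
    proof (intro allI impI)
      fix k assume k: "k < q"
      have "\<bar>c / (2 * s) * (w k - v k)\<bar> = c / (2 * s) * \<bar>v k - w k\<bar>"
        using c \<open>s > 0\<close> by (simp add: abs_mult abs_minus_commute)
      also have "\<dots> \<le> c / (2 * s) * s" using mem[OF k] c \<open>s > 0\<close> by (intro mult_left_mono) auto
      also have "\<dots> = c / 2" using \<open>s > 0\<close> by simp
      finally have "\<bar>c / (2 * s) * (w k - v k)\<bar> \<le> c / 2" .
      moreover have "\<bar>w k - u k\<bar> \<le> c / 2" using w k by blast
      ultimately show "\<bar>w' k - u k\<bar> \<le> c" unfolding w'_def by linarith
    qed
    have vc: "\<forall>k<q. \<bar>v k - u k\<bar> \<le> c" using v(2) c by (smt (verit) field_sum_of_halves)
    \<comment> \<open>The solution of \<open>\<theta> * (1 + c / (2 * s)) = 1\<close>, which places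
      \<open>w\<close> on the segment from \<open>v\<close> to \<open>w'\<close>.\<close>
    define \<theta> where "\<theta> = 2 * s / (2 * s + c)"
    have \<theta>: "0 \<le> \<theta>" "\<theta> \<le> 1" using c \<open>s > 0\<close> by (auto simp: \<theta>_def)
    have "comb \<theta> v w' = w"
    proof
      fix k
      have nz: "2 * s + c \<noteq> 0" "s \<noteq> 0" using c \<open>s > 0\<close> by auto
      have "\<theta> * (1 + c / (2 * s)) = \<theta> * ((2 * s + c) / (2 * s))"
        using nz by (simp add: add_divide_distrib)
      also have "\<dots> = 1" unfolding \<theta>_def using nz by simp
      finally have "\<theta> * (1 + c / (2 * s)) = 1" .
      moreover have "comb \<theta> v w' k = v k + (\<theta> * (1 + c / (2 * s))) * (w k - v k)"
        by (simp add: comb_def w'_def algebra_simps)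
      ultimately show "comb \<theta> v w' k = w k" by simp
    qed
    then have "h w \<le> (1 - \<theta>) * h v + \<theta> * h w'"
      using strict_cvx_onD[OF h, of v w' \<theta>] cube v(1) vc w' w'c \<theta> by auto
    then have "h w - h v \<le> \<theta> * (h w' - h v)" by (simp add: algebra_simps)
    also have "\<dots> \<le> \<theta> * K" using K[OF v(1) vc w' w'c] \<theta> by (intro mult_left_mono) auto
    also have "\<dots> \<le> 2 * s / c * K"
      unfolding \<theta>_def using K0 c \<open>s > 0\<close> by (intro mult_right_mono divide_left_mono) auto
    also have "\<dots> = 2 * K / c * s" by simp
    finally show ?thesis unfolding s_def .
  qed
  have "\<bar>h v - h w\<bar> \<le> 2 * K / c * (\<Sum>k<q. \<bar>v k - w k\<bar>)"
    if v: "v \<in> Rn q" "\<forall>k<q. \<bar>v k - u k\<bar> \<le> c / 2" and w: "w \<in> Rn q" "\<forall>k<q. \<bar>w k - u k\<bar> \<le> c / 2" for v w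
  proof -
    have eq: "(\<Sum>k<q. \<bar>w k - v k\<bar>) = (\<Sum>k<q. \<bar>v k - w k\<bar>)" by (simp add: abs_minus_commute)
    show ?thesis using lip[OF v w] lip[OF w v, unfolded eq] by linarith
  qed
  then show ?thesis using c by (intro exI[of _ "c / 2"] conjI exI[of _ "2 * K / c"]) simp_all
qed

section \<open>The Lagrangian gap\<close>

lemma strict_cvx_on_seq_continuous:
  assumes h: "strict_cvx_on q U h" and U: "open_Rn q U" and p: "p \<in> U"
    and w: "\<And>j. w j \<in> Rn q" and lim: "\<And>k. k < q \<Longrightarrow> (\<lambda>j::nat. w j k) \<longlonglongrightarrow> p k"
  shows "(\<lambda>j. h (w j)) \<longlonglongrightarrow> h p"
proof -
  obtain e M where e: "e > 0" and M: "\<forall>v\<in>Rn q. \<forall>w\<in>Rn q. (\<forall>k<q. \<bar>v k - p k\<bar> \<le> e) \<longrightarrow>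
      (\<forall>k<q. \<bar>w k - p k\<bar> \<le> e) \<longrightarrow> \<bar>h v - h w\<bar> \<le> M * (\<Sum>k<q. \<bar>v k - w k\<bar>)"
    using strict_cvx_on_locally_Lipschitz[OF h U p] by blast
  have pR: "p \<in> Rn q" using U p unfolding open_Rn_def by blast
  have "\<forall>\<^sub>F j in sequentially. \<forall>k\<in>{..<q}. \<bar>w j k - p k\<bar> \<le> e"
  proof (rule eventually_ball_finite)
    show "\<forall>k\<in>{..<q}. \<forall>\<^sub>F j in sequentially. \<bar>w j k - p k\<bar> \<le> e"
    proof
      fix k assume "k \<in> {..<q}"
      then have "\<forall>\<^sub>F j in sequentially. dist (w j k) (p k) < e"
        using lim e by (intro tendstoD) auto
      then show "\<forall>\<^sub>F j in sequentially. \<bar>w j k - p k\<bar> \<le> e"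
        by eventually_elim (simp add: dist_real_def)
    qed
  qed auto
  then have ev: "\<forall>\<^sub>F j in sequentially. norm (h (w j) - h p) \<le> M * (\<Sum>k<q. \<bar>w j k - p k\<bar>)"
  proof eventually_elim
    case (elim j)
    then show ?case using M w[of j] pR e by auto
  qed
  have "(\<lambda>j. M * (\<Sum>k<q. \<bar>w j k - p k\<bar>)) \<longlonglongrightarrow> M * (\<Sum>k<q. \<bar>p k - p k\<bar>)"
    by (intro tendsto_intros lim) auto
  then have "(\<lambda>j. h (w j) - h p) \<longlonglongrightarrow> 0"
    using ev by (intro Lim_null_comparison[OF ev]) simp
  then show ?thesis by (simp add: LIM_zero_iff)
qed

lemma Wmul_comb:
  "Wmul m qi Wi (comb \<theta> u v) r = (1 - \<theta>) * Wmul m qi Wi u r + \<theta> * Wmul m qi Wi v r"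
  by (simp add: Wmul_def comb_def sum_distrib_left sum.distrib[symmetric] algebra_simps)

lemma ip_Wmul_adjoint:
  "(\<Sum>r<m. l r * Wmul m qi Wi v r) = (\<Sum>k<qi. WTmul m qi Wi l k * v k)"
proof -
  have "(\<Sum>r<m. l r * Wmul m qi Wi v r) = (\<Sum>r<m. \<Sum>k<qi. l r * (Wi r k * v k))"
    by (simp add: Wmul_def sum_distrib_left)
  also have "\<dots> = (\<Sum>k<qi. \<Sum>r<m. l r * (Wi r k * v k))" by (rule sum.swap)
  also have "\<dots> = (\<Sum>k<qi. WTmul m qi Wi l k * v k)"
    by (intro sum.cong refl) (simp add: WTmul_def sum_distrib_left mult.left_commute mult.commute)
  finally show ?thesis .
qed

lemma Xset_comb:
  assumes "\<And>i. i < n \<Longrightarrow> cvx_set (Om i)" "u \<in> Xset n Om" "v \<in> Xset n Om" "0 \<le> \<theta>" "\<theta> \<le> 1"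
  shows "(\<lambda>i. comb \<theta> (u i) (v i)) \<in> Xset n Om"
proof -
  have "comb \<theta> (u i) (v i) \<in> Om i" if "i < n" for i
    using assms that unfolding Xset_def cvx_set_def by blast
  then show ?thesis using assms(2,3) by (auto simp: Xset_def comb_def)
qed

section \<open>Slater's condition and the Lagrange multiplier\<close>

text \<open>Here \<open>affine_multipliers\<close> is applied to the excess of the objective over
  the optimum. Reversal of constraint values comes from the Slater point \<open>x0\<close>: as it is
  interior, a small step from it away from \<open>y\<close> stays in the constraint set, and as it
  is feasible, the residual there is a negative multiple of that of \<open>y\<close>.\<close>

lemma Lagrange_multiplier_exists:
  assumes Om_convex: "\<forall>i<n. cvx_set (Om i)"
    and Om_Rn: "\<forall>i<n. Om i \<subseteq> Rn (q i)"
    and U_open: "\<forall>i<n. Om i \<subseteq> U i"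
    and f_strict: "\<forall>i<n. strict_cvx_on (q i) (U i) (f i)"
    and x0: "\<forall>i<n. x0 i \<in> interior_Rn (q i) (Om i)" "\<forall>i\<ge>n. x0 i = (\<lambda>_. 0)"
      "\<forall>r<m. (\<Sum>i<n. Wmul m (q i) (W i) (x0 i) r) = (\<Sum>i<n. d i r)"
    and opt: "is_optimal n m q Om f W d xs"
  shows "\<exists>\<mu>. \<forall>y\<in>Xset n Om. (\<Sum>r<m. \<mu> r * ((\<Sum>i<n. Wmul m (q i) (W i) (y i) r) - (\<Sum>i<n. d i r)))
      \<le> (\<Sum>i<n. f i (y i)) - (\<Sum>i<n. f i (xs i))"
proof (rule affine_multipliers[where C = "\<lambda>\<theta> u v i. comb \<theta> (u i) (v i)"])
  fix u v \<theta> assume uv: "u \<in> Xset n Om" "v \<in> Xset n Om" and \<theta>: "0 \<le> (\<theta>::real)" "\<theta> \<le> 1"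
  show "(\<lambda>i. comb \<theta> (u i) (v i)) \<in> Xset n Om"
    using Om_convex by (intro Xset_comb uv \<theta>) auto
  have "(\<Sum>i<n. f i (comb \<theta> (u i) (v i))) \<le> (\<Sum>i<n. (1 - \<theta>) * f i (u i) + \<theta> * f i (v i))"
  proof (rule sum_mono)
    fix i assume "i \<in> {..<n}"
    then have "Om i \<subseteq> U i" "u i \<in> Om i" "v i \<in> Om i" "strict_cvx_on (q i) (U i) (f i)"
      using uv U_open f_strict by (auto simp: Xset_def)
    then show "f i (comb \<theta> (u i) (v i)) \<le> (1 - \<theta>) * f i (u i) + \<theta> * f i (v i)"
      using \<theta> by (intro strict_cvx_onD[of "q i" "U i"]) auto
  qed
  also have "\<dots> = (1 - \<theta>) * (\<Sum>i<n. f i (u i)) + \<theta> * (\<Sum>i<n. f i (v i))"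
    by (simp add: sum.distrib sum_distrib_left)
  finally show "(\<Sum>i<n. f i (comb \<theta> (u i) (v i))) - (\<Sum>i<n. f i (xs i)) \<le>
      (1 - \<theta>) * ((\<Sum>i<n. f i (u i)) - (\<Sum>i<n. f i (xs i))) + \<theta> * ((\<Sum>i<n. f i (v i)) - (\<Sum>i<n. f i (xs i)))"
    by (simp add: algebra_simps)
  have "(\<Sum>i<n. Wmul m (q i) (W i) (comb \<theta> (u i) (v i)) r) =
      (1 - \<theta>) * (\<Sum>i<n. Wmul m (q i) (W i) (u i) r) + \<theta> * (\<Sum>i<n. Wmul m (q i) (W i) (v i) r)" for r
    by (simp add: Wmul_comb sum.distrib sum_distrib_left)
  then show "(\<Sum>i<n. Wmul m (q i) (W i) (comb \<theta> (u i) (v i)) r) - (\<Sum>i<n. d i r) =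
      (1 - \<theta>) * ((\<Sum>i<n. Wmul m (q i) (W i) (u i) r) - (\<Sum>i<n. d i r)) +
      \<theta> * ((\<Sum>i<n. Wmul m (q i) (W i) (v i) r) - (\<Sum>i<n. d i r))" for r
    by (simp add: algebra_simps)
next
  fix y assume y: "y \<in> Xset n Om"
  show "0 \<le> (\<Sum>i<n. f i (y i)) - (\<Sum>i<n. f i (xs i))"
    if "\<forall>r<m. (\<Sum>i<n. Wmul m (q i) (W i) (y i) r) - (\<Sum>i<n. d i r) = 0"
    using opt y that unfolding is_optimal_def feasible_def by simp
  have "\<exists>s0>0. \<forall>s. 0 < s \<and> s < s0 \<longrightarrow> (\<lambda>k. x0 i k - s * (y i k - x0 i k)) \<in> Om i" if i: "i < n" for i
  proof -
    have x0i: "x0 i \<in> Om i" using x0 i unfolding interior_Rn_def by auto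
    obtain e where e: "e > 0" "\<forall>v\<in>Rn (q i). nrm (q i) (\<lambda>k. v k - x0 i k) < e \<longrightarrow> v \<in> Om i"
      using x0 i unfolding interior_Rn_def by auto
    \<comment> \<open>A positive bound for the length of \<open>y i - x0 i\<close>; steps below
      \<open>e / N\<close> remain in the ball around \<open>x0 i\<close>.\<close>
    define N where "N = (\<Sum>k<q i. \<bar>y i k - x0 i k\<bar>) + 1"
    have N: "N > 0" unfolding N_def by (intro add_nonneg_pos sum_nonneg) auto
    have "(\<lambda>k. x0 i k - s * (y i k - x0 i k)) \<in> Om i" if s: "0 < s" "s < e / N" for s
    proof -
      have R: "y i \<in> Rn (q i)" "x0 i \<in> Rn (q i)" using y x0i Om_Rn i by (auto simp: Xset_def)
      have "nrm (q i) (\<lambda>k. (x0 i k - s * (y i k - x0 i k)) - x0 i k) \<le>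
          (\<Sum>k<q i. \<bar>(x0 i k - s * (y i k - x0 i k)) - x0 i k\<bar>)" by (rule nrm_le_sum_abs)
      also have "\<dots> = s * (\<Sum>k<q i. \<bar>y i k - x0 i k\<bar>)"
        using s by (simp add: abs_mult sum_distrib_left)
      also have "\<dots> \<le> s * N" using s by (simp add: N_def)
      also have "\<dots> < e" using s N by (simp add: field_simps)
      finally show ?thesis using e(2) R by (auto simp: Rn_def)
    qed
    then show ?thesis using e N by (intro exI[of _ "e / N"]) auto
  qed
  then have "\<forall>i\<in>{..<n}. \<exists>s0>0. \<forall>s. 0 < s \<and> s < s0 \<longrightarrow> (\<lambda>k. x0 i k - s * (y i k - x0 i k)) \<in> Om i"
    by simp
  then obtain s0 where s0: "\<forall>i\<in>{..<n}. s0 i > 0 \<and>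
      (\<forall>s. 0 < s \<and> s < s0 i \<longrightarrow> (\<lambda>k. x0 i k - s * (y i k - x0 i k)) \<in> Om i)"
    by (rule bchoice[THEN exE])
  define s where "s = Min (insert 1 (s0 ` {..<n})) / 2"
  have "Min (insert 1 (s0 ` {..<n})) > 0" using s0 by auto
  then have s: "s > 0" "s < Min (insert 1 (s0 ` {..<n}))" by (auto simp: s_def)
  then have s': "s < s0 i" if "i < n" for i using that by auto
  define y' where "y' i = (\<lambda>k. x0 i k - s * (y i k - x0 i k))" for i
  have "y' \<in> Xset n Om"
    using s0 s s' x0(2) y by (auto simp: y'_def Xset_def)
  moreover have "(\<Sum>i<n. Wmul m (q i) (W i) (y' i) r) - (\<Sum>i<n. d i r) =
      - s * ((\<Sum>i<n. Wmul m (q i) (W i) (y i) r) - (\<Sum>i<n. d i r))" if "r < m" for r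
  proof -
    \<comment> \<open>\<open>Wmul_comb\<close> holds for every real weight, hence also for this
      extrapolation with a negative one.\<close>
    have "y' i = comb (- s) (x0 i) (y i)" for i by (auto simp: y'_def comb_def algebra_simps)
    then have "(\<Sum>i<n. Wmul m (q i) (W i) (y' i) r) =
        (1 + s) * (\<Sum>i<n. Wmul m (q i) (W i) (x0 i) r) - s * (\<Sum>i<n. Wmul m (q i) (W i) (y i) r)"
      by (simp add: Wmul_comb sum.distrib sum_subtractf sum_distrib_left)
    then show ?thesis using x0(3) that by (simp add: algebra_simps)
  qed
  ultimately show "\<exists>y'\<in>Xset n Om. \<exists>s>0. \<forall>r<m. (\<Sum>i<n. Wmul m (q i) (W i) (y' i) r) - (\<Sum>i<n. d i r) =
      - s * ((\<Sum>i<n. Wmul m (q i) (W i) (y i) r) - (\<Sum>i<n. d i r))"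
    using s(1) by blast
qed

section \<open>The gap function near and away from the optimum\<close>

text \<open>The data of an equilibrium. With every agent holding the same multiplier \<mu> the
  Laplacian of the multipliers vanishes, and the equation for \<open>zs\<close> balances the local
  residuals. Optimality of \<open>xs\<close> is contained in \<open>multiplier\<close>, whose left
  side is zero for feasible \<open>y\<close>.\<close>

locale saddle_point =
  fixes n m :: nat and q :: "nat \<Rightarrow> nat" and a :: "nat \<Rightarrow> nat \<Rightarrow> real"
    and Om U :: "nat \<Rightarrow> (nat \<Rightarrow> real) set" and f :: "nat \<Rightarrow> (nat \<Rightarrow> real) \<Rightarrow> real"
    and W :: "nat \<Rightarrow> nat \<Rightarrow> nat \<Rightarrow> real" and d :: "nat \<Rightarrow> nat \<Rightarrow> real"
    and xs :: "nat \<Rightarrow> nat \<Rightarrow> real" and \<mu> :: "nat \<Rightarrow> real" and zs :: "nat \<Rightarrow> nat \<Rightarrow> real"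
  assumes graph: "weighted_graph n a"
    and Om_closed: "\<And>i. i < n \<Longrightarrow> closed_Rn (q i) (Om i)"
    and Om_convex: "\<And>i. i < n \<Longrightarrow> cvx_set (Om i)"
    and U_open: "\<And>i. i < n \<Longrightarrow> open_Rn (q i) (U i)"
    and Om_U: "\<And>i. i < n \<Longrightarrow> Om i \<subseteq> U i"
    and f_strict: "\<And>i. i < n \<Longrightarrow> strict_cvx_on (q i) (U i) (f i)"
    and feas: "feasible n m q Om W d xs"
    and multiplier: "\<And>y. y \<in> Xset n Om \<Longrightarrow>
      (\<Sum>r<m. \<mu> r * ((\<Sum>i<n. Wmul m (q i) (W i) (y i) r) - (\<Sum>i<n. d i r)))
      \<le> (\<Sum>i<n. f i (y i)) - (\<Sum>i<n. f i (xs i))"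
    and zs: "\<And>i r. i < n \<Longrightarrow> r < m \<Longrightarrow> lap n m a zs i r = d i r - Wmul m (q i) (W i) (xs i) r"
begin

text \<open>The Lagrangian at \<open>y\<close> minus the Lagrangian at \<open>xs\<close>, where the
  constraint term vanishes.\<close>

definition gap :: "(nat \<Rightarrow> nat \<Rightarrow> real) \<Rightarrow> real" where
  "gap y = (\<Sum>i<n. f i (y i)) - (\<Sum>i<n. f i (xs i))
     - (\<Sum>r<m. \<mu> r * ((\<Sum>i<n. Wmul m (q i) (W i) (y i) r) - (\<Sum>i<n. d i r)))"

lemma xs_Xset: "xs \<in> Xset n Om"
  using feas by (simp add: feasible_def)

lemma xs_constraint: "r < m \<Longrightarrow> (\<Sum>i<n. Wmul m (q i) (W i) (xs i) r) = (\<Sum>i<n. d i r)"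
  using feas by (simp add: feasible_def)

lemma Om_Rn: "i < n \<Longrightarrow> Om i \<subseteq> Rn (q i)"
  using Om_closed by (auto simp: closed_Rn_def)

lemma gap_nonneg: "y \<in> Xset n Om \<Longrightarrow> 0 \<le> gap y"
  using multiplier by (simp add: gap_def)

text \<open>At the midpoint of \<open>y\<close> and \<open>xs\<close> strict convexity puts the gap
  below half of \<open>gap y\<close>, because the gap at \<open>xs\<close> is zero; at the midpoint
  it is still nonnegative.\<close>

lemma gap_pos:
  assumes y: "y \<in> Xset n Om" and ne: "y \<noteq> xs"
  shows "0 < gap y"
proof -
  define v where "v i = comb (1/2) (y i) (xs i)" for i
  have v: "v \<in> Xset n Om"
    unfolding v_def by (intro Xset_comb Om_convex y xs_Xset) auto
  have "\<exists>i<n. y i \<noteq> xs i"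
  proof (rule ccontr)
    assume eq: "\<not> ?thesis"
    have "y i = xs i" for i
      using eq y xs_Xset by (cases "i < n") (auto simp: Xset_def)
    then show False using ne by blast
  qed
  then obtain i0 where i0: "i0 < n" "y i0 \<noteq> xs i0" by blast
  have mem: "y i \<in> U i" "xs i \<in> U i" if "i < n" for i
    using y xs_Xset Om_U[OF that] that by (auto simp: Xset_def)
  have "(\<Sum>i<n. f i (v i)) < (\<Sum>i<n. f i (y i) / 2 + f i (xs i) / 2)"
  proof (rule sum_strict_mono_ex1)
    show "\<forall>i\<in>{..<n}. f i (v i) \<le> f i (y i) / 2 + f i (xs i) / 2"
      using strict_cvx_onD[OF f_strict mem, of _ "1/2"] by (auto simp: v_def)
    have "f i0 (v i0) < f i0 (y i0) / 2 + f i0 (xs i0) / 2"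
      using f_strict[OF i0(1), unfolded strict_cvx_on_def, rule_format, OF mem[OF i0(1)] i0(2), of "1/2"]
      by (simp add: v_def)
    then show "\<exists>i\<in>{..<n}. f i (v i) < f i (y i) / 2 + f i (xs i) / 2" using i0 by blast
  qed auto
  then have "(\<Sum>i<n. f i (v i)) < (\<Sum>i<n. f i (y i)) / 2 + (\<Sum>i<n. f i (xs i)) / 2"
    by (simp add: sum.distrib sum_divide_distrib)
  moreover have "(\<Sum>r<m. \<mu> r * ((\<Sum>i<n. Wmul m (q i) (W i) (v i) r) - (\<Sum>i<n. d i r))) =
      (\<Sum>r<m. \<mu> r * ((\<Sum>i<n. Wmul m (q i) (W i) (y i) r) - (\<Sum>i<n. d i r))) / 2"
    unfolding sum_divide_distrib
  proof (intro sum.cong refl)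
    fix r assume "r \<in> {..<m}"
    then have "(\<Sum>i<n. Wmul m (q i) (W i) (v i) r) =
        (\<Sum>i<n. Wmul m (q i) (W i) (y i) r) / 2 + (\<Sum>i<n. d i r) / 2"
      using xs_constraint[of r] by (simp add: v_def Wmul_comb sum.distrib sum_divide_distrib[symmetric])
    then show "\<mu> r * ((\<Sum>i<n. Wmul m (q i) (W i) (v i) r) - (\<Sum>i<n. d i r)) =
      \<mu> r * ((\<Sum>i<n. Wmul m (q i) (W i) (y i) r) - (\<Sum>i<n. d i r)) / 2"
      by (simp add: algebra_simps)
  qed
  \<comment> \<open>Here \<open>A\<close>, \<open>B\<close>, \<open>C\<close> stand for the
    objective at \<open>v\<close>, \<open>y\<close>, \<open>xs\<close>, and \<open>D\<close>,
    \<open>E\<close> for the multiplier terms at \<open>v\<close> and \<open>y\<close>.\<close>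
  moreover have "A - C - D < (B - C - E) / 2" if "A < B / 2 + C / 2" "D = E / 2" for A B C D E :: real
    using that by (simp add: field_simps)
  ultimately have "gap v < gap y / 2" unfolding gap_def by blast
  then show ?thesis using gap_nonneg[OF v] by linarith
qed

text \<open>Compactness: otherwise a bounded sequence with gaps tending to 0 has a subsequence
  converging to a point of the constraint set with gap at most 0. By \<open>gap_pos\<close> this is
  \<open>xs\<close>, although one coordinate stays \<epsilon> away.\<close>

lemma gap_bounded_below:
  assumes \<epsilon>: "\<epsilon> > 0" and ik: "i0 < n" "k0 < q i0"
  shows "\<exists>c>0. \<forall>y\<in>Xset n Om. (\<forall>i<n. \<forall>k<q i. \<bar>y i k\<bar> \<le> B) \<longrightarrow> \<epsilon> \<le> \<bar>y i0 k0 - xs i0 k0\<bar> \<longrightarrow> c \<le> gap y"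
proof (rule ccontr)
  assume neg: "\<not> ?thesis"
  have "\<exists>y. y \<in> Xset n Om \<and> (\<forall>i<n. \<forall>k<q i. \<bar>y i k\<bar> \<le> B) \<and> \<epsilon> \<le> \<bar>y i0 k0 - xs i0 k0\<bar> \<and>
      gap y < 1 / real (Suc j)" for j
  proof -
    have "1 / real (Suc j) > 0" by simp
    then show ?thesis using neg by (meson not_le)
  qed
  then obtain y where y: "\<And>j. y j \<in> Xset n Om" "\<And>j i k. i < n \<Longrightarrow> k < q i \<Longrightarrow> \<bar>y j i k\<bar> \<le> B"
      "\<And>j. \<epsilon> \<le> \<bar>y j i0 k0 - xs i0 k0\<bar>" "\<And>j. gap (y j) < 1 / real (Suc j)"
    by metis
  define I where "I = Sigma {..<n} (\<lambda>i. {..<q i})"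
  have "\<exists>r p. strict_mono (r :: nat \<Rightarrow> nat) \<and> (\<forall>ik\<in>I. (\<lambda>j. y (r j) (fst ik) (snd ik)) \<longlonglongrightarrow> p ik)"
    by (rule bounded_coords_convergent_subseq[where B = "\<lambda>_. B"]) (use y(2) in \<open>auto simp: I_def\<close>)
  then obtain r p where r: "strict_mono (r :: nat \<Rightarrow> nat)"
      "\<forall>ik\<in>I. (\<lambda>j. y (r j) (fst ik) (snd ik)) \<longlonglongrightarrow> p ik" by blast
  define v where "v i k = (if i < n \<and> k < q i then p (i, k) else 0)" for i k
  have lim: "(\<lambda>j. y (r j) i k) \<longlonglongrightarrow> v i k" if "i < n" "k < q i" for i k
    using r(2) that by (auto simp: I_def v_def)
  have vOm: "v i \<in> Om i" if "i < n" for i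
    by (rule closed_Rn_limit[OF Om_closed[OF that], of "\<lambda>j. y (r j) i"])
       (use y(1) that lim in \<open>auto simp: Rn_def v_def Xset_def\<close>)
  have v: "v \<in> Xset n Om"
    using vOm by (auto simp: Xset_def v_def)
  have f_lim: "(\<lambda>j. f i (y (r j) i)) \<longlonglongrightarrow> f i (v i)" if i: "i < n" for i
    using y(1) Om_Rn[OF i] Om_U[OF i] vOm[OF i] lim[OF i] i
    by (intro strict_cvx_on_seq_continuous[OF f_strict[OF i] U_open[OF i]]) (auto simp: Xset_def)
  have W_lim: "(\<lambda>j. Wmul m (q i) (W i) (y (r j) i) s) \<longlonglongrightarrow> Wmul m (q i) (W i) (v i) s" if "i < n" for i s
    unfolding Wmul_def by (cases "s < m") (auto intro!: tendsto_intros lim that)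
  have "(\<lambda>j. gap (y (r j))) \<longlonglongrightarrow> gap v"
    unfolding gap_def by (intro tendsto_intros f_lim W_lim) auto
  moreover have "(\<lambda>j. 1 / real (Suc (r j))) \<longlonglongrightarrow> 0"
    using LIMSEQ_subseq_LIMSEQ[OF LIMSEQ_inverse_real_of_nat r(1)] by (simp add: o_def inverse_eq_divide)
  ultimately have "gap v \<le> 0"
    using y(4) by (intro LIMSEQ_le[of _ _ "\<lambda>j. 1 / real (Suc (r j))"]) (auto intro: less_imp_le)
  then have "v = xs" using gap_pos[OF v] by force
  moreover have "\<epsilon> \<le> \<bar>v i0 k0 - xs i0 k0\<bar>"
    using y(3) by (intro LIMSEQ_le_const[of "\<lambda>j. \<bar>y (r j) i0 k0 - xs i0 k0\<bar>"] tendsto_intros lim ik) auto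
  ultimately show False using \<epsilon> by simp
qed

section \<open>Dissipation on the right-hand side of the inclusion\<close>

text \<open>The projected point is \<open>X + p\<close>. Its variational inequality is tested with
  \<open>xs i\<close>; the product of \<open>g\<close> with \<open>xs i - X\<close> is bounded by
  the subgradient inequality, and the transposed matrix is moved over by adjointness.\<close>

lemma Fmap_local_inequality:
  assumes i: "i < n" and X: "X \<in> Om i" and g: "g \<in> subgrad (q i) (U i) (f i) X"
    and p: "\<And>k. k < q i \<Longrightarrow>
      p k = proj (q i) (Om i) (\<lambda>k'. X k' - g k' + WTmul m (q i) (W i) L k') k - X k"
  shows "(\<Sum>k<q i. g k * p k) + (\<Sum>k<q i. (X k - xs i k) * p k) + (\<Sum>k<q i. (p k)\<^sup>2)
      + (f i X - f i (xs i)) \<le> (\<Sum>r<m. L r * (Wmul m (q i) (W i) X r - Wmul m (q i) (W i) (xs i) r))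
      + (\<Sum>r<m. L r * Wmul m (q i) (W i) p r)"
proof -
  let ?\<omega> = "WTmul m (q i) (W i) L" and ?y = "\<lambda>k. X k - g k + WTmul m (q i) (W i) L k"
  have xsi: "xs i \<in> Om i" using xs_Xset i by (auto simp: Xset_def)
  have "ip (q i) (\<lambda>k. ?y k - proj (q i) (Om i) ?y k) (\<lambda>k. xs i k - proj (q i) (Om i) ?y k) \<le> 0"
    using X xsi by (intro proj_variational(2) Om_closed Om_convex i) auto
  also have "ip (q i) (\<lambda>k. ?y k - proj (q i) (Om i) ?y k) (\<lambda>k. xs i k - proj (q i) (Om i) ?y k) =
      (\<Sum>k<q i. (- g k + ?\<omega> k - p k) * (xs i k - X k - p k))"
    unfolding ip_def by (intro sum.cong refl) (simp add: p)
  also have "\<dots> = (\<Sum>k<q i. g k * p k) + (\<Sum>k<q i. (X k - xs i k) * p k) + (\<Sum>k<q i. (p k)\<^sup>2)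
      - (\<Sum>k<q i. g k * (xs i k - X k)) - (\<Sum>k<q i. ?\<omega> k * (X k - xs i k)) - (\<Sum>k<q i. ?\<omega> k * p k)"
    by (simp add: sum.distrib[symmetric] sum_subtractf[symmetric] algebra_simps power2_eq_square)
  finally have "(\<Sum>k<q i. g k * p k) + (\<Sum>k<q i. (X k - xs i k) * p k) + (\<Sum>k<q i. (p k)\<^sup>2)
      - (\<Sum>k<q i. g k * (xs i k - X k)) - (\<Sum>k<q i. ?\<omega> k * (X k - xs i k)) - (\<Sum>k<q i. ?\<omega> k * p k) \<le> 0" .
  moreover have "f i (xs i) \<ge> f i X + (\<Sum>k<q i. g k * (xs i k - X k))"
    using g Om_U[OF i] xsi by (auto simp: subgrad_def ip_def)
  moreover have "(\<Sum>k<q i. ?\<omega> k * (X k - xs i k)) =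
      (\<Sum>r<m. L r * (Wmul m (q i) (W i) X r - Wmul m (q i) (W i) (xs i) r))"
    unfolding right_diff_distrib sum_subtractf by (simp add: ip_Wmul_adjoint)
  moreover have "(\<Sum>k<q i. ?\<omega> k * p k) = (\<Sum>r<m. L r * Wmul m (q i) (W i) p r)"
    by (simp add: ip_Wmul_adjoint)
  ultimately show ?thesis by linarith
qed

text \<open>The first term is half the quadratic form of \<open>L\<close>, since \<mu> is the same
  for all agents and drops out of differences. The other two cancel by symmetry of the
  Laplacian.\<close>

lemma laplacian_terms_nonneg:
  "0 \<le> (\<Sum>i<n. \<Sum>r<m. (L i r - \<mu> r) * lap n m a L i r + (L i r - \<mu> r) * (lap n m a Z i r - lap n m a zs i r)
      - (Z i r - zs i r) * lap n m a L i r)"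
proof -
  have sym: "a i j = a j i" if "i < n" "j < n" for i j
    using graph that by (auto simp: weighted_graph_def)
  have "0 \<le> (\<Sum>i<n. (L i r - \<mu> r) * lap n m a L i r + (L i r - \<mu> r) * (lap n m a Z i r - lap n m a zs i r)
      - (Z i r - zs i r) * lap n m a L i r)" if r: "r < m" for r
  proof -
    let ?Q = "\<lambda>y v. \<Sum>i<n. \<Sum>j<n. a i j * ((y i - y j) * (v i - v j))"
    have 1: "(\<Sum>i<n. (L i r - \<mu> r) * lap n m a L i r) = ?Q (\<lambda>i. L i r) (\<lambda>i. L i r) / 2"
      using r sum_mult_laplacian[of n a "\<lambda>i. L i r - \<mu> r" "\<lambda>i. L i r"] sym by (simp add: lap_def)
    have "(\<Sum>i<n. (L i r - \<mu> r) * (lap n m a Z i r - lap n m a zs i r)) =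
        (\<Sum>i<n. (L i r - \<mu> r) * (\<Sum>j<n. a i j * ((Z i r - zs i r) - (Z j r - zs j r))))"
      using r by (intro sum.cong refl) (simp add: lap_def sum_subtractf[symmetric] algebra_simps)
    also have "\<dots> = ?Q (\<lambda>i. L i r) (\<lambda>i. Z i r - zs i r) / 2"
      using sum_mult_laplacian[of n a "\<lambda>i. L i r - \<mu> r" "\<lambda>i. Z i r - zs i r"] sym by simp
    finally have 2: "(\<Sum>i<n. (L i r - \<mu> r) * (lap n m a Z i r - lap n m a zs i r)) =
      ?Q (\<lambda>i. L i r) (\<lambda>i. Z i r - zs i r) / 2" .
    have 3: "(\<Sum>i<n. (Z i r - zs i r) * lap n m a L i r) = ?Q (\<lambda>i. L i r) (\<lambda>i. Z i r - zs i r) / 2"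
      using r sum_mult_laplacian[of n a "\<lambda>i. Z i r - zs i r" "\<lambda>i. L i r"] sym
      by (simp add: lap_def mult.commute)
    have "0 \<le> ?Q (\<lambda>i. L i r) (\<lambda>i. L i r)"
      using graph by (intro sum_nonneg mult_nonneg_nonneg[OF _ zero_le_square]) (auto simp: weighted_graph_def)
    then show ?thesis unfolding sum_subtractf sum.distrib 1 2 3 by simp
  qed
  then show ?thesis by (subst sum.swap) (rule sum_nonneg, simp)
qed

text \<open>With \<open>g\<close> in the role of a gradient of the objective, the left side is the
  formal chain-rule derivative of the gap plus half the squared distances. The subgradient is the
  one selected by the inclusion, hence the existential quantifier.\<close>

lemma Fmap_dissipation:
  assumes X: "X \<in> Xset n Om" and F: "(p, u, w) \<in> Fmap n m q a Om U f W d X L Z"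
  shows "\<exists>g. (\<forall>i<n. g i \<in> subgrad (q i) (U i) (f i) (X i)) \<and>
    (\<Sum>i<n. \<Sum>k<q i. g i k * p i k) - (\<Sum>r<m. \<mu> r * (\<Sum>i<n. Wmul m (q i) (W i) (p i) r))
    + (\<Sum>i<n. \<Sum>k<q i. (X i k - xs i k) * p i k) + (\<Sum>i<n. \<Sum>r<m. (L i r - \<mu> r) * u i r)
    + (\<Sum>i<n. \<Sum>r<m. (Z i r - zs i r) * w i r)
    \<le> - (\<Sum>i<n. \<Sum>k<q i. (p i k)\<^sup>2) - gap X"
proof -
  let ?W = "\<lambda>i v r. Wmul m (q i) (W i) v r"
  obtain g where g: "\<forall>i<n. g i \<in> subgrad (q i) (U i) (f i) (X i)"
    and p: "\<And>i k. i < n \<Longrightarrow> k < q i \<Longrightarrow>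
      p i k = proj (q i) (Om i) (\<lambda>k'. X i k' - g i k' + WTmul m (q i) (W i) (L i) k') k - X i k"
    and u: "\<And>i r. i < n \<Longrightarrow> r < m \<Longrightarrow>
      u i r = d i r - ?W i (X i) r - lap n m a L i r - lap n m a Z i r - ?W i (p i) r"
    and w: "\<And>i r. i < n \<Longrightarrow> w i r = lap n m a L i r"
    using F unfolding Fmap_def by auto
  have local: "(\<Sum>k<q i. g i k * p i k) + (\<Sum>k<q i. (X i k - xs i k) * p i k) + (\<Sum>k<q i. (p i k)\<^sup>2)
      + (f i (X i) - f i (xs i)) \<le> (\<Sum>r<m. L i r * (?W i (X i) r - ?W i (xs i) r))
      + (\<Sum>r<m. L i r * ?W i (p i) r)" if i: "i < n" for i
    using g X p i by (intro Fmap_local_inequality) (auto simp: Xset_def)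
  have "(\<Sum>i<n. (\<Sum>k<q i. g i k * p i k) + (\<Sum>k<q i. (X i k - xs i k) * p i k) + (\<Sum>k<q i. (p i k)\<^sup>2)
      + (f i (X i) - f i (xs i))) \<le> (\<Sum>i<n. (\<Sum>r<m. L i r * (?W i (X i) r - ?W i (xs i) r))
      + (\<Sum>r<m. L i r * ?W i (p i) r))"
    by (rule sum_mono) (use local in auto)
  then have A: "(\<Sum>i<n. \<Sum>k<q i. g i k * p i k) + (\<Sum>i<n. \<Sum>k<q i. (X i k - xs i k) * p i k)
      + (\<Sum>i<n. \<Sum>k<q i. (p i k)\<^sup>2) + ((\<Sum>i<n. f i (X i)) - (\<Sum>i<n. f i (xs i)))
      \<le> (\<Sum>i<n. \<Sum>r<m. L i r * (?W i (X i) r - ?W i (xs i) r) + L i r * ?W i (p i) r)"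
    by (simp add: sum.distrib sum_subtractf)
  \<comment> \<open>After inserting \<open>u\<close>, \<open>w\<close> and the equation for
    \<open>zs\<close>, everything containing \<open>L\<close> cancels; in particular the damping
    term with \<open>p\<close> in \<open>u\<close> absorbs the product of \<open>L\<close> with the
    image of \<open>p\<close>. Only terms with \<mu> remain, and these belong to the gap and its
    derivative.\<close>
  have "(\<Sum>i<n. \<Sum>r<m. (L i r - \<mu> r) * u i r) + (\<Sum>i<n. \<Sum>r<m. (Z i r - zs i r) * w i r)
      + (\<Sum>i<n. \<Sum>r<m. (L i r - \<mu> r) * lap n m a L i r
        + (L i r - \<mu> r) * (lap n m a Z i r - lap n m a zs i r) - (Z i r - zs i r) * lap n m a L i r)
      + (\<Sum>i<n. \<Sum>r<m. L i r * (?W i (X i) r - ?W i (xs i) r) + L i r * ?W i (p i) r)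
      = (\<Sum>i<n. \<Sum>r<m. \<mu> r * (?W i (X i) r - ?W i (xs i) r) + \<mu> r * ?W i (p i) r)"
    unfolding sum.distrib[symmetric]
    by (intro sum.cong refl) (simp add: u w zs algebra_simps)
  also have "\<dots> = (\<Sum>r<m. \<Sum>i<n. \<mu> r * (?W i (X i) r - ?W i (xs i) r) + \<mu> r * ?W i (p i) r)"
    by (rule sum.swap)
  also have "\<dots> = (\<Sum>r<m. \<mu> r * ((\<Sum>i<n. ?W i (X i) r) - (\<Sum>i<n. d i r)) + \<mu> r * (\<Sum>i<n. ?W i (p i) r))"
    by (intro sum.cong refl)
       (simp add: sum.distrib sum_subtractf sum_distrib_left[symmetric] xs_constraint)
  also have "\<dots> = (\<Sum>r<m. \<mu> r * ((\<Sum>i<n. ?W i (X i) r) - (\<Sum>i<n. d i r))) + (\<Sum>r<m. \<mu> r * (\<Sum>i<n. ?W i (p i) r))"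
    by (rule sum.distrib)
  finally have B: "(\<Sum>i<n. \<Sum>r<m. (L i r - \<mu> r) * u i r) + (\<Sum>i<n. \<Sum>r<m. (Z i r - zs i r) * w i r)
      + (\<Sum>i<n. \<Sum>r<m. (L i r - \<mu> r) * lap n m a L i r
        + (L i r - \<mu> r) * (lap n m a Z i r - lap n m a zs i r) - (Z i r - zs i r) * lap n m a L i r)
      + (\<Sum>i<n. \<Sum>r<m. L i r * (?W i (X i) r - ?W i (xs i) r) + L i r * ?W i (p i) r)
      = (\<Sum>r<m. \<mu> r * ((\<Sum>i<n. ?W i (X i) r) - (\<Sum>i<n. d i r))) + (\<Sum>r<m. \<mu> r * (\<Sum>i<n. ?W i (p i) r))" .
  show ?thesis
    using A B laplacian_terms_nonneg[of L Z] unfolding gap_def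
    by (intro exI[of _ g] conjI g) linarith
qed

end

section \<open>Solutions of the differential inclusion\<close>

lemma has_real_derivative_left_diff_le:
  assumes "(K has_real_derivative D) (at t)" "D \<le> 0" "\<epsilon> > 0"
  shows "\<exists>\<eta>>0. \<forall>u. t - \<eta> < u \<and> u < t \<longrightarrow> K t - K u \<le> \<epsilon> * (t - u)"
proof -
  have "(\<lambda>u. (K u - K t) / (u - t)) \<midarrow>t\<rightarrow> D"
    using assms(1) by (simp add: has_field_derivative_iff)
  from LIM_D[OF this assms(3)] obtain \<eta> where \<eta>: "\<eta> > 0"
    "\<And>u. u \<noteq> t \<Longrightarrow> \<bar>u - t\<bar> < \<eta> \<Longrightarrow> \<bar>(K u - K t) / (u - t) - D\<bar> < \<epsilon>"
    by auto
  have "K t - K u \<le> \<epsilon> * (t - u)" if u: "t - \<eta> < u" "u < t" for u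
  proof -
    have "(K u - K t) / (u - t) < \<epsilon>" using \<eta>(2)[of u] u assms(2) by auto
    moreover have "(K u - K t) / (u - t) = (K t - K u) / (t - u)"
      using minus_divide_divide[of "K u - K t" "u - t"] by simp
    ultimately show ?thesis using u by (simp add: pos_divide_less_eq less_imp_le)
  qed
  then show ?thesis using \<eta>(1) by blast
qed

text \<open>The function \<open>K\<close> may depend on \<open>t\<close>: its increments up to
  \<open>t\<close> dominate those of \<open>h\<close>, so its derivative bounds the left difference
  quotients of \<open>h\<close>. For the Lyapunov function, \<open>K\<close> has the objective
  replaced by a linear minorant.\<close>

lemma abs_cont_on_derivative_nonpos_imp_le:
  assumes "a \<le> b" "abs_cont_on {a..b} h"
    and ae: "AE t in lebesgue. a < t \<and> t < b \<longrightarrow>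
      (\<exists>K D. (K has_real_derivative D) (at t) \<and> D \<le> 0 \<and> (\<forall>u. a \<le> u \<and> u < t \<longrightarrow> h t - h u \<le> K t - K u))"
  shows "h b \<le> h a"
proof (rule abs_cont_on_left_diff_imp_le[OF assms(1,2)])
  show "AE t in lebesgue. a < t \<and> t < b \<longrightarrow>
      (\<forall>\<epsilon>>0. \<exists>\<eta>>0. \<forall>u. t - \<eta> < u \<and> u < t \<and> a \<le> u \<longrightarrow> h t - h u \<le> \<epsilon> * (t - u))"
    using ae
  proof (rule eventually_mono, intro impI allI)
    fix t \<epsilon> :: real
    assume "a < t \<and> t < b \<longrightarrow>
      (\<exists>K D. (K has_real_derivative D) (at t) \<and> D \<le> 0 \<and> (\<forall>u. a \<le> u \<and> u < t \<longrightarrow> h t - h u \<le> K t - K u))"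
      and "a < t \<and> t < b" and \<epsilon>: "\<epsilon> > 0"
    then obtain K D where K: "(K has_real_derivative D) (at t)" "D \<le> 0"
      "\<forall>u. a \<le> u \<and> u < t \<longrightarrow> h t - h u \<le> K t - K u" by blast
    obtain \<eta> where \<eta>: "\<eta> > 0" "\<forall>u. t - \<eta> < u \<and> u < t \<longrightarrow> K t - K u \<le> \<epsilon> * (t - u)"
      using has_real_derivative_left_diff_le[OF K(1,2) \<epsilon>] by blast
    have "h t - h u \<le> \<epsilon> * (t - u)" if "t - \<eta> < u" "u < t" "a \<le> u" for u
      using K(3) \<eta>(2) that by force
    then show "\<exists>\<eta>>0. \<forall>u. t - \<eta> < u \<and> u < t \<and> a \<le> u \<longrightarrow> h t - h u \<le> \<epsilon> * (t - u)"
      using \<eta>(1) by blast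
  qed
qed

lemma member_le_double_sum:
  fixes h :: "nat \<Rightarrow> nat \<Rightarrow> real"
  assumes "i < n" "k < K i" "\<And>i k. 0 \<le> h i k"
  shows "h i k \<le> (\<Sum>i<n. \<Sum>k<K i. h i k)"
proof -
  have "h i k \<le> (\<Sum>k<K i. h i k)" using assms by (intro member_le_sum) auto
  also have "\<dots> \<le> (\<Sum>i<n. \<Sum>k<K i. h i k)"
    using assms by (intro member_le_sum[of i "{..<n}" "\<lambda>i. \<Sum>k<K i. h i k"] sum_nonneg) auto
  finally show ?thesis .
qed

section \<open>Invariance of the constraint set\<close>

locale trajectory = saddle_point +
  fixes x l z :: "real \<Rightarrow> nat \<Rightarrow> nat \<Rightarrow> real"
  assumes sol: "is_solution n m q a Om U f W d x l z" and x0: "x 0 \<in> Xset n Om"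
begin

lemma x_ac: "0 \<le> \<alpha> \<Longrightarrow> i < n \<Longrightarrow> k < q i \<Longrightarrow> abs_cont_on {\<alpha>..\<beta>} (\<lambda>t. x t i k)"
  and l_ac: "0 \<le> \<alpha> \<Longrightarrow> i < n \<Longrightarrow> r < m \<Longrightarrow> abs_cont_on {\<alpha>..\<beta>} (\<lambda>t. l t i r)"
  and z_ac: "0 \<le> \<alpha> \<Longrightarrow> i < n \<Longrightarrow> r < m \<Longrightarrow> abs_cont_on {\<alpha>..\<beta>} (\<lambda>t. z t i r)"
  using sol unfolding is_solution_def
  \<comment> \<open>Solutions are absolutely continuous on \<open>{0..T}\<close> for
    \<open>T \<ge> 0\<close>; \<open>max 0 \<beta>\<close> is such a \<open>T\<close> for every
    \<beta>.\<close>
  by (auto intro!: abs_cont_on_subset[of "{0..max 0 \<beta>}" _ "{\<alpha>..\<beta>}"])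

lemma x_Xspace: "0 \<le> t \<Longrightarrow> x t \<in> Xspace n q"
  using sol unfolding is_solution_def by blast

lemma x_Rn: "0 \<le> t \<Longrightarrow> i < n \<Longrightarrow> x t i \<in> Rn (q i)"
  using x_Xspace unfolding Xspace_def Xset_def by auto

definition velocity :: "real \<Rightarrow> (nat \<Rightarrow> nat \<Rightarrow> real) \<Rightarrow> (nat \<Rightarrow> nat \<Rightarrow> real) \<Rightarrow> (nat \<Rightarrow> nat \<Rightarrow> real) \<Rightarrow> bool" where
  "velocity t p u w \<longleftrightarrow> (p, u, w) \<in> Fmap n m q a Om U f W d (x t) (l t) (z t) \<and>
     (\<forall>i<n. (\<forall>k<q i. ((\<lambda>s. x s i k) has_real_derivative p i k) (at t)) \<and>
            (\<forall>r<m. ((\<lambda>s. l s i r) has_real_derivative u i r) (at t) \<and>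
                   ((\<lambda>s. z s i r) has_real_derivative w i r) (at t)))"

lemma AE_velocity: "AE t in lebesgue. t > 0 \<longrightarrow> (\<exists>p u w. velocity t p u w)"
  using sol unfolding is_solution_def velocity_def by blast

text \<open>Each half-space containing the constraint set is invariant, since x + dx/dt lies in it.\<close>

lemma halfspace_invariant:
  assumes i: "i < n" and T: "0 \<le> T" and half: "\<And>v. v \<in> Om i \<Longrightarrow> (\<Sum>k<q i. c k * v k) \<le> b"
  shows "(\<Sum>k<q i. c k * x T i k) \<le> b"
proof (rule ccontr)
  define \<phi> where "\<phi> t = (\<Sum>k<q i. c k * x t i k)" for t
  assume "\<not> ?thesis"
  then have \<phi>T: "\<phi> T > b" by (simp add: \<phi>_def)
  have \<phi>0: "\<phi> 0 \<le> b" unfolding \<phi>_def using x0 i by (intro half) (auto simp: Xset_def)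
  have \<phi>_ac: "abs_cont_on {\<alpha>..\<beta>} \<phi>" if "0 \<le> \<alpha>" for \<alpha> \<beta>
    unfolding \<phi>_def by (intro abs_cont_on_sum abs_cont_on_cmult x_ac i that) auto
  \<comment> \<open>Its supremum \<open>s\<close> is the last time up to \<open>T\<close> at which
    the half-space constraint holds. After \<open>s\<close> it is violated, so \<phi> cannot grow,
    which contradicts \<open>\<phi> s \<le> b < \<phi> T\<close>.\<close>
  define S where "S = {t \<in> {0..T}. \<phi> t \<le> b}"
  have "closed S"
    unfolding S_def using continuous_closed_preimage[OF abs_cont_on_imp_continuous_on[OF \<phi>_ac], of 0 T "{..b}"]
    by (auto simp: vimage_def Int_def)
  moreover have S: "S \<noteq> {}" "bdd_above S"
    using \<phi>0 T by (auto simp: S_def intro!: bdd_aboveI[of _ T])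
  ultimately have "Sup S \<in> S" by (intro closed_contains_Sup)
  define s where "s = Sup S"
  have s: "0 \<le> s" "s \<le> T" "\<phi> s \<le> b" using \<open>Sup S \<in> S\<close> by (auto simp: S_def s_def)
  have above: "\<phi> t > b" if "s < t" "t \<le> T" for t
  proof (rule ccontr)
    assume "\<not> \<phi> t > b"
    then have "t \<in> S" using that s by (auto simp: S_def)
    then have "t \<le> s" unfolding s_def using S by (intro cSup_upper)
    then show False using that by simp
  qed
  have "\<phi> T \<le> \<phi> s"
  proof (rule abs_cont_on_derivative_nonpos_imp_le[where h = \<phi>])
    show "AE t in lebesgue. s < t \<and> t < T \<longrightarrow>
      (\<exists>K D. (K has_real_derivative D) (at t) \<and> D \<le> 0 \<and> (\<forall>u. s \<le> u \<and> u < t \<longrightarrow> \<phi> t - \<phi> u \<le> K t - K u))"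
      using AE_velocity
    proof (rule eventually_mono, intro impI)
      fix t assume "t > 0 \<longrightarrow> (\<exists>p u w. velocity t p u w)" and t: "s < t \<and> t < T"
      then obtain p u w where v: "velocity t p u w" using s by auto
      have "(\<phi> has_real_derivative (\<Sum>k<q i. c k * p i k)) (at t)"
        unfolding \<phi>_def using v i by (auto simp: velocity_def intro!: DERIV_sum DERIV_cmult)
      moreover have "(\<Sum>k<q i. c k * p i k) \<le> 0"
      proof -
        obtain y where p: "\<And>k. k < q i \<Longrightarrow> p i k = proj (q i) (Om i) y k - x t i k"
          using v i unfolding velocity_def Fmap_def by auto
        have "proj (q i) (Om i) y \<in> Om i"
          using x0 i by (intro proj_variational(1) Om_closed Om_convex) (auto simp: Xset_def)
        then have "(\<Sum>k<q i. c k * proj (q i) (Om i) y k) \<le> b" by (rule half)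
        moreover have "\<phi> t > b" using above t by simp
        moreover have "(\<Sum>k<q i. c k * p i k) = (\<Sum>k<q i. c k * proj (q i) (Om i) y k) - \<phi> t"
          unfolding \<phi>_def sum_subtractf[symmetric]
          by (intro sum.cong refl) (simp add: p right_diff_distrib)
        ultimately show ?thesis by linarith
      qed
      ultimately show "\<exists>K D. (K has_real_derivative D) (at t) \<and> D \<le> 0 \<and>
          (\<forall>u. s \<le> u \<and> u < t \<longrightarrow> \<phi> t - \<phi> u \<le> K t - K u)" by blast
    qed
  qed (use s \<phi>_ac in auto)
  then show False using \<phi>T s by simp
qed

text \<open>The half-space supporting the constraint set at the projection \<open>y\<close> of
  \<open>x t i\<close>, with normal \<open>x t i - y\<close>, is invariant; this makes the squared
  distance to \<open>y\<close> nonpositive.\<close>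

lemma x_Xset:
  assumes t: "0 \<le> t"
  shows "x t \<in> Xset n Om"
proof -
  have "x t i \<in> Om i" if i: "i < n" for i
  proof -
    define y where "y = proj (q i) (Om i) (x t i)"
    have ne: "Om i \<noteq> {}" using x0 i by (auto simp: Xset_def)
    note P = proj_variational[OF Om_closed[OF i] Om_convex[OF i] ne, where y = "x t i", folded y_def]
    have "(\<Sum>k<q i. (x t i k - y k) * x t i k) \<le> (\<Sum>k<q i. (x t i k - y k) * y k)"
    proof (rule halfspace_invariant[OF i t])
      fix v assume "v \<in> Om i"
      from P(2)[OF this] show "(\<Sum>k<q i. (x t i k - y k) * v k) \<le> (\<Sum>k<q i. (x t i k - y k) * y k)"
        by (simp add: ip_def right_diff_distrib sum_subtractf)
    qed
    then have "ip (q i) (\<lambda>k. x t i k - y k) (\<lambda>k. x t i k - y k) \<le> 0"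
      by (simp add: ip_def right_diff_distrib sum_subtractf)
    then have "nrm (q i) (\<lambda>k. x t i k - y k) \<le> 0" by (simp add: nrm_def)
    then have "x t i k = y k" if "k < q i" for k
      using abs_le_nrm[OF that, of "\<lambda>k. x t i k - y k"] by simp
    moreover have "y \<in> Rn (q i)" "x t i \<in> Rn (q i)" using P(1) Om_Rn[OF i] x_Rn[OF t i] by auto
    ultimately have "x t i k = y k" for k by (cases "k < q i") (auto simp: Rn_def)
    then have "x t i = y" by blast
    then show ?thesis using P(1) by simp
  qed
  then show ?thesis using x_Xspace[OF t] by (auto simp: Xspace_def Xset_def)
qed

section \<open>The Lyapunov function and its decrease\<close>

definition V :: "real \<Rightarrow> real" where
  "V t = gap (x t) + (\<Sum>i<n. \<Sum>k<q i. (x t i k - xs i k)\<^sup>2) / 2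
     + (\<Sum>i<n. \<Sum>r<m. (l t i r - \<mu> r)\<^sup>2) / 2 + (\<Sum>i<n. \<Sum>r<m. (z t i r - zs i r)\<^sup>2) / 2"

text \<open>Each \<open>f i\<close> is replaced by its linear minorant with the subgradient selected
  at time \<open>t\<close>. The resulting \<open>G\<close> is differentiable at \<open>t\<close>
  with the derivative estimated in \<open>Fmap_dissipation\<close>, and the subgradient inequality
  compares its increments with those of \<open>V\<close>.\<close>

lemma V_left_derivative:
  assumes t: "t > 0" and v: "velocity t p u w"
  shows "\<exists>G D. (G has_real_derivative D) (at t) \<and> D \<le> - (\<Sum>i<n. \<Sum>k<q i. (p i k)\<^sup>2) - gap (x t) \<and>
      (\<forall>s\<ge>0. V t - V s \<le> G t - G s)"
proof -
  have F: "(p, u, w) \<in> Fmap n m q a Om U f W d (x t) (l t) (z t)"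
    and dx: "\<And>i k. i < n \<Longrightarrow> k < q i \<Longrightarrow> ((\<lambda>s. x s i k) has_real_derivative p i k) (at t)"
    and dl: "\<And>i r. i < n \<Longrightarrow> r < m \<Longrightarrow> ((\<lambda>s. l s i r) has_real_derivative u i r) (at t)"
    and dz: "\<And>i r. i < n \<Longrightarrow> r < m \<Longrightarrow> ((\<lambda>s. z s i r) has_real_derivative w i r) (at t)"
    using v unfolding velocity_def by auto
  obtain g where g: "\<forall>i<n. g i \<in> subgrad (q i) (U i) (f i) (x t i)"
    and diss: "(\<Sum>i<n. \<Sum>k<q i. g i k * p i k) - (\<Sum>r<m. \<mu> r * (\<Sum>i<n. Wmul m (q i) (W i) (p i) r))
    + (\<Sum>i<n. \<Sum>k<q i. (x t i k - xs i k) * p i k) + (\<Sum>i<n. \<Sum>r<m. (l t i r - \<mu> r) * u i r)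
    + (\<Sum>i<n. \<Sum>r<m. (z t i r - zs i r) * w i r)
    \<le> - (\<Sum>i<n. \<Sum>k<q i. (p i k)\<^sup>2) - gap (x t)"
    using Fmap_dissipation[OF x_Xset F] t by auto
  define G where "G s = (\<Sum>i<n. \<Sum>k<q i. g i k * x s i k)
     - (\<Sum>r<m. \<mu> r * (\<Sum>i<n. Wmul m (q i) (W i) (x s i) r))
     + (\<Sum>i<n. \<Sum>k<q i. (x s i k - xs i k)\<^sup>2) / 2
     + (\<Sum>i<n. \<Sum>r<m. (l s i r - \<mu> r)\<^sup>2) / 2 + (\<Sum>i<n. \<Sum>r<m. (z s i r - zs i r)\<^sup>2) / 2" for s
  have dW: "((\<lambda>s. Wmul m (q i) (W i) (x s i) r) has_real_derivative Wmul m (q i) (W i) (p i) r) (at t)"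
    if "i < n" "r < m" for i r
    unfolding Wmul_def using that by (auto intro!: DERIV_sum DERIV_cmult dx)
  have sq: "((\<lambda>s. (\<Sum>i<n. \<Sum>k<K i. (y s i k - c i k)\<^sup>2) / 2) has_real_derivative
      (\<Sum>i<n. \<Sum>k<K i. (y t i k - c i k) * y' i k)) (at t)"
    if dy: "\<And>i k. i < n \<Longrightarrow> k < K i \<Longrightarrow> ((\<lambda>s. y s i k) has_real_derivative y' i k) (at t)"
    for y :: "real \<Rightarrow> nat \<Rightarrow> nat \<Rightarrow> real" and c y' K
  proof -
    have "((\<lambda>s. (y s i k - c i k)\<^sup>2 / 2) has_real_derivative (y t i k - c i k) * y' i k) (at t)"
      if "i < n" "k < K i" for i k
      using DERIV_cdivide[OF DERIV_power[OF DERIV_diff[OF dy[OF that] DERIV_const], of "c i k" 2], of 2]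
      by (simp add: mult.commute)
    then show ?thesis unfolding sum_divide_distrib by (auto intro!: DERIV_sum)
  qed
  have "(G has_real_derivative ((\<Sum>i<n. \<Sum>k<q i. g i k * p i k)
    - (\<Sum>r<m. \<mu> r * (\<Sum>i<n. Wmul m (q i) (W i) (p i) r))
    + (\<Sum>i<n. \<Sum>k<q i. (x t i k - xs i k) * p i k) + (\<Sum>i<n. \<Sum>r<m. (l t i r - \<mu> r) * u i r)
    + (\<Sum>i<n. \<Sum>r<m. (z t i r - zs i r) * w i r))) (at t)"
    unfolding G_def
    by (intro DERIV_add DERIV_diff sq DERIV_sum DERIV_cmult) (auto intro: dx dl dz dW)
  moreover have "V t - V s \<le> G t - G s" if s: "0 \<le> s" for s
  proof -
    have "f i (x t i) - f i (x s i) \<le> (\<Sum>k<q i. g i k * x t i k) - (\<Sum>k<q i. g i k * x s i k)" if i: "i < n" for i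
    proof -
      have "x s i \<in> U i" using x_Xset[OF s] Om_U[OF i] i by (auto simp: Xset_def)
      then have "f i (x s i) \<ge> f i (x t i) + (\<Sum>k<q i. g i k * (x s i k - x t i k))"
        using g i by (auto simp: subgrad_def ip_def)
      then show ?thesis by (simp add: right_diff_distrib sum_subtractf)
    qed
    then have "(\<Sum>i<n. f i (x t i) - f i (x s i)) \<le>
        (\<Sum>i<n. (\<Sum>k<q i. g i k * x t i k) - (\<Sum>k<q i. g i k * x s i k))"
      by (intro sum_mono) auto
    then show ?thesis
      unfolding V_def G_def gap_def by (simp add: sum_subtractf right_diff_distrib)
  qed
  ultimately show ?thesis using diss by blast
qed

text \<open>The Lipschitz constant of \<open>f i\<close> is available only near
  \<open>x t i\<close>, so absolute continuity is obtained on short intervals around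
  \<open>t\<close>, where continuity keeps \<open>x\<close> in that cube.\<close>

lemma f_x_locally_ac:
  assumes t: "0 \<le> t" and i: "i < n"
  shows "\<exists>\<eta>>0. \<forall>\<alpha> \<beta>. 0 \<le> \<alpha> \<and> \<alpha> \<le> t \<and> t \<le> \<beta> \<and> \<beta> - \<alpha> < \<eta> \<longrightarrow> abs_cont_on {\<alpha>..\<beta>} (\<lambda>s. f i (x s i))"
proof -
  have xU: "x t i \<in> U i" using x_Xset[OF t] Om_U[OF i] i by (auto simp: Xset_def)
  obtain e M where e: "e > 0" and M: "\<forall>v\<in>Rn (q i). \<forall>w\<in>Rn (q i). (\<forall>k<q i. \<bar>v k - x t i k\<bar> \<le> e) \<longrightarrow>
      (\<forall>k<q i. \<bar>w k - x t i k\<bar> \<le> e) \<longrightarrow> \<bar>f i v - f i w\<bar> \<le> M * (\<Sum>k<q i. \<bar>v k - w k\<bar>)"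
    using strict_cvx_on_locally_Lipschitz[OF f_strict[OF i] U_open[OF i] xU] by blast
  have "\<forall>\<^sub>F s in at t within {0..t+1}. \<forall>k\<in>{..<q i}. \<bar>x s i k - x t i k\<bar> \<le> e"
  proof (rule eventually_ball_finite)
    show "\<forall>k\<in>{..<q i}. \<forall>\<^sub>F s in at t within {0..t+1}. \<bar>x s i k - x t i k\<bar> \<le> e"
    proof
      fix k assume "k \<in> {..<q i}"
      then have "continuous_on {0..t+1} (\<lambda>s. x s i k)"
        using t i by (intro abs_cont_on_imp_continuous_on x_ac) auto
      then have "((\<lambda>s. x s i k) \<longlongrightarrow> x t i k) (at t within {0..t+1})"
        using t by (auto simp: continuous_on_def)
      from tendstoD[OF this e] show "\<forall>\<^sub>F s in at t within {0..t+1}. \<bar>x s i k - x t i k\<bar> \<le> e"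
        by eventually_elim (simp add: dist_real_def)
    qed
  qed auto
  then obtain \<delta> where \<delta>: "\<delta> > 0" "\<And>s. s \<in> {0..t+1} \<Longrightarrow> s \<noteq> t \<Longrightarrow> dist s t < \<delta> \<Longrightarrow> \<forall>k<q i. \<bar>x s i k - x t i k\<bar> \<le> e"
    unfolding eventually_at by auto
  \<comment> \<open>The punctured limit says nothing at \<open>s = t\<close>, where the difference
    is zero; the bound 1 keeps \<open>s\<close> below \<open>t + 1\<close>.\<close>
  have near: "\<forall>k<q i. \<bar>x s i k - x t i k\<bar> \<le> e" if "0 \<le> s" "\<bar>s - t\<bar> < min \<delta> 1" for s
    using \<delta>(2)[of s] that e by (cases "s = t") (auto simp: dist_real_def)
  have "abs_cont_on {\<alpha>..\<beta>} (\<lambda>s. f i (x s i))" if ab: "0 \<le> \<alpha> \<and> \<alpha> \<le> t \<and> t \<le> \<beta> \<and> \<beta> - \<alpha> < min \<delta> 1" for \<alpha> \<beta>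
  proof (rule abs_cont_on_dominated[where I = "{..<q i}" and y = "\<lambda>k s. x s i k" and M = M])
    show "\<bar>f i (x s i) - f i (x s' i)\<bar> \<le> M * (\<Sum>k<q i. \<bar>x s i k - x s' i k\<bar>)"
      if s: "s \<in> {\<alpha>..\<beta>}" and s': "s' \<in> {\<alpha>..\<beta>}" for s s'
    proof -
      have "0 \<le> s" "0 \<le> s'" using s s' ab by auto
      moreover have "\<bar>s - t\<bar> < min \<delta> 1" "\<bar>s' - t\<bar> < min \<delta> 1" using s s' ab by auto
      ultimately show ?thesis using M near x_Rn i by blast
    qed
    show "abs_cont_on {\<alpha>..\<beta>} (\<lambda>s. x s i k)" if "k \<in> {..<q i}" for k
      using that ab by (intro x_ac i) auto
  qed auto
  then show ?thesis using \<delta>(1) by (intro exI[of _ "min \<delta> 1"]) auto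
qed

lemma V_locally_ac:
  assumes t: "0 \<le> t"
  shows "\<exists>\<eta>>0. \<forall>\<alpha> \<beta>. 0 \<le> \<alpha> \<and> \<alpha> \<le> t \<and> t \<le> \<beta> \<and> \<beta> - \<alpha> < \<eta> \<longrightarrow> abs_cont_on {\<alpha>..\<beta>} V"
proof -
  have "\<forall>i\<in>{..<n}. \<exists>\<eta>>0. \<forall>\<alpha> \<beta>. 0 \<le> \<alpha> \<and> \<alpha> \<le> t \<and> t \<le> \<beta> \<and> \<beta> - \<alpha> < \<eta> \<longrightarrow>
      abs_cont_on {\<alpha>..\<beta>} (\<lambda>s. f i (x s i))"
    using f_x_locally_ac[OF t] by simp
  then obtain H where H: "\<forall>i\<in>{..<n}. H i > 0 \<and> (\<forall>\<alpha> \<beta>. 0 \<le> \<alpha> \<and> \<alpha> \<le> t \<and> t \<le> \<beta> \<and> \<beta> - \<alpha> < H i \<longrightarrow>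
      abs_cont_on {\<alpha>..\<beta>} (\<lambda>s. f i (x s i)))"
    by (rule bchoice[THEN exE])
  define \<eta> where "\<eta> = Min (insert 1 (H ` {..<n}))"
  have \<eta>: "\<eta> > 0" "\<And>i. i < n \<Longrightarrow> \<eta> \<le> H i" using H by (auto simp: \<eta>_def)
  have "abs_cont_on {\<alpha>..\<beta>} V" if ab: "0 \<le> \<alpha>" "\<alpha> \<le> t" "t \<le> \<beta>" "\<beta> - \<alpha> < \<eta>" for \<alpha> \<beta>
  proof -
    have fac: "abs_cont_on {\<alpha>..\<beta>} (\<lambda>s. f i (x s i))" if "i < n" for i
      using H \<eta>(2)[OF that] that ab by (auto dest: less_le_trans)
    have xac: "abs_cont_on {\<alpha>..\<beta>} (\<lambda>s. x s i k)" if "i < n" "k < q i" for i k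
      using that ab by (intro x_ac) auto
    have lac: "abs_cont_on {\<alpha>..\<beta>} (\<lambda>s. l s i r)" "abs_cont_on {\<alpha>..\<beta>} (\<lambda>s. z s i r)" if "i < n" "r < m" for i r
      using that ab by (auto intro!: l_ac z_ac)
    have Wac: "abs_cont_on {\<alpha>..\<beta>} (\<lambda>s. Wmul m (q i) (W i) (x s i) r)" if "i < n" "r < m" for i r
      unfolding Wmul_def using that by (auto intro!: abs_cont_on_sum abs_cont_on_cmult xac)
    have half: "abs_cont_on {\<alpha>..\<beta>} (\<lambda>s. h s / 2)" if "abs_cont_on {\<alpha>..\<beta>} h" for h
      using abs_cont_on_cmult[OF that, of "1/2"] by simp
    show ?thesis
      unfolding V_def gap_def
      by (intro abs_cont_on_add abs_cont_on_diff abs_cont_on_sum abs_cont_on_cmult half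
          abs_cont_on_power2 abs_cont_on_const fac xac lac Wac) auto
  qed
  then show ?thesis using \<eta>(1) by blast
qed

text \<open>Any \<open>R\<close> whose rate is paid for by the dissipation may be added to
  \<open>V\<close> without losing monotonicity. The choices are 0 for decrease, a signed coordinate
  minus \<open>t / 4\<close> for increments of \<open>x\<close>, and \<open>c * t\<close> for the
  consumption by the gap.\<close>

lemma V_dissipation:
  assumes st: "0 \<le> s" "s \<le> t" and R: "abs_cont_on {s..t} R"
    and dR: "\<And>\<tau> p u w. s < \<tau> \<Longrightarrow> \<tau> < t \<Longrightarrow> velocity \<tau> p u w \<Longrightarrow>
      \<exists>\<rho>. (R has_real_derivative \<rho>) (at \<tau>) \<and> \<rho> \<le> (\<Sum>i<n. \<Sum>k<q i. (p i k)\<^sup>2) + gap (x \<tau>)"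
  shows "V t + R t \<le> V s + R s"
proof -
  \<comment> \<open>Bisection passes from local to global: the inequality is additive over adjacent
    intervals and holds on short ones around each point. The guard confines all intervals to
    \<open>{s..t}\<close>.\<close>
  have "s \<le> s \<and> t \<le> t \<longrightarrow> V t + R t \<le> V s + R s"
  proof (rule Bolzano[OF st(2), where P = "\<lambda>\<alpha> \<beta>. s \<le> \<alpha> \<and> \<beta> \<le> t \<longrightarrow> V \<beta> + R \<beta> \<le> V \<alpha> + R \<alpha>"])
    fix \<tau> assume \<tau>: "s \<le> \<tau>" "\<tau> \<le> t"
    obtain \<eta> where \<eta>: "\<eta> > 0" "\<forall>\<alpha> \<beta>. 0 \<le> \<alpha> \<and> \<alpha> \<le> \<tau> \<and> \<tau> \<le> \<beta> \<and> \<beta> - \<alpha> < \<eta> \<longrightarrow> abs_cont_on {\<alpha>..\<beta>} V"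
      using V_locally_ac[of \<tau>] \<tau> st by auto
    have "V \<beta> + R \<beta> \<le> V \<alpha> + R \<alpha>" if ab: "\<alpha> \<le> \<tau>" "\<tau> \<le> \<beta>" "\<beta> - \<alpha> < \<eta>" "s \<le> \<alpha>" "\<beta> \<le> t" for \<alpha> \<beta>
    proof (rule abs_cont_on_derivative_nonpos_imp_le[where h = "\<lambda>\<tau>. V \<tau> + R \<tau>"])
      show "\<alpha> \<le> \<beta>" using ab by simp
      have "{\<alpha>..\<beta>} \<subseteq> {s..t}" using ab by auto
      then show "abs_cont_on {\<alpha>..\<beta>} (\<lambda>\<tau>. V \<tau> + R \<tau>)"
        using \<eta>(2) ab st by (intro abs_cont_on_add abs_cont_on_subset[OF R]) auto
      show "AE \<tau> in lebesgue. \<alpha> < \<tau> \<and> \<tau> < \<beta> \<longrightarrow> (\<exists>K D. (K has_real_derivative D) (at \<tau>) \<and> D \<le> 0 \<and>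
          (\<forall>u. \<alpha> \<le> u \<and> u < \<tau> \<longrightarrow> V \<tau> + R \<tau> - (V u + R u) \<le> K \<tau> - K u))"
        using AE_velocity
      proof (rule eventually_mono, intro impI)
        fix \<tau> assume "\<tau> > 0 \<longrightarrow> (\<exists>p u w. velocity \<tau> p u w)" and \<tau>: "\<alpha> < \<tau> \<and> \<tau> < \<beta>"
        then obtain p u w where v: "velocity \<tau> p u w" using ab st by auto
        have "\<tau> > 0" using \<tau> ab st by simp
        then obtain G D where G: "(G has_real_derivative D) (at \<tau>)"
          "D \<le> - (\<Sum>i<n. \<Sum>k<q i. (p i k)\<^sup>2) - gap (x \<tau>)" "\<forall>s\<ge>0. V \<tau> - V s \<le> G \<tau> - G s"
          using V_left_derivative[OF _ v] by blast
        obtain \<rho> where \<rho>: "(R has_real_derivative \<rho>) (at \<tau>)" "\<rho> \<le> (\<Sum>i<n. \<Sum>k<q i. (p i k)\<^sup>2) + gap (x \<tau>)"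
          using dR[OF _ _ v] \<tau> ab by auto
        have "((\<lambda>\<tau>. G \<tau> + R \<tau>) has_real_derivative D + \<rho>) (at \<tau>)"
          by (intro DERIV_add G \<rho>)
        moreover have "D + \<rho> \<le> 0" using G(2) \<rho>(2) by linarith
        moreover have "V \<tau> + R \<tau> - (V u + R u) \<le> (G \<tau> + R \<tau>) - (G u + R u)" if "\<alpha> \<le> u" for u
        proof -
          have "V \<tau> - V u \<le> G \<tau> - G u" using G(3) that ab st by auto
          then show ?thesis by linarith
        qed
        ultimately show "\<exists>K D. (K has_real_derivative D) (at \<tau>) \<and> D \<le> 0 \<and>
          (\<forall>u. \<alpha> \<le> u \<and> u < \<tau> \<longrightarrow> V \<tau> + R \<tau> - (V u + R u) \<le> K \<tau> - K u)"
          by (intro exI[of _ "\<lambda>\<tau>. G \<tau> + R \<tau>"] exI[of _ "D + \<rho>"]) auto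
      qed
    qed
    then show "\<exists>d>0. \<forall>\<alpha> \<beta>. \<alpha> \<le> \<tau> \<and> \<tau> \<le> \<beta> \<and> \<beta> - \<alpha> < d \<longrightarrow> (s \<le> \<alpha> \<and> \<beta> \<le> t \<longrightarrow> V \<beta> + R \<beta> \<le> V \<alpha> + R \<alpha>)"
      using \<eta>(1) by blast
  qed auto
  then show ?thesis by simp
qed

lemma V_antimono:
  assumes "0 \<le> s" "s \<le> t"
  shows "V t \<le> V s"
proof -
  have "V t + 0 \<le> V s + 0"
  proof (rule V_dissipation[OF assms, where R = "\<lambda>_. 0"])
    fix \<tau> and p u w :: "nat \<Rightarrow> nat \<Rightarrow> real" assume "s < \<tau>"
    have "0 \<le> (\<Sum>i<n. \<Sum>k<q i. (p i k)\<^sup>2)" by (intro sum_nonneg) auto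
    moreover have "0 \<le> gap (x \<tau>)" using \<open>s < \<tau>\<close> assms by (intro gap_nonneg x_Xset) auto
    ultimately show "\<exists>\<rho>. ((\<lambda>_. 0) has_real_derivative \<rho>) (at \<tau>) \<and> \<rho> \<le> (\<Sum>i<n. \<Sum>k<q i. (p i k)\<^sup>2) + gap (x \<tau>)"
      by (intro exI[of _ 0]) auto
  qed (rule abs_cont_on_const)
  then show ?thesis by simp
qed

lemma V_bounds:
  assumes t: "0 \<le> t"
  shows "0 \<le> V t"
    and "i < n \<Longrightarrow> k < q i \<Longrightarrow> (x t i k - xs i k)\<^sup>2 \<le> 2 * V t"
    and "i < n \<Longrightarrow> r < m \<Longrightarrow> (l t i r - \<mu> r)\<^sup>2 \<le> 2 * V t"
    and "i < n \<Longrightarrow> r < m \<Longrightarrow> (z t i r - zs i r)\<^sup>2 \<le> 2 * V t"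
proof -
  have g: "0 \<le> gap (x t)" by (intro gap_nonneg x_Xset t)
  have A: "0 \<le> (\<Sum>i<n. \<Sum>k<q i. (x t i k - xs i k)\<^sup>2)" "0 \<le> (\<Sum>i<n. \<Sum>r<m. (l t i r - \<mu> r)\<^sup>2)"
    "0 \<le> (\<Sum>i<n. \<Sum>r<m. (z t i r - zs i r)\<^sup>2)" by (intro sum_nonneg; simp)+
  show "0 \<le> V t" using g A unfolding V_def by linarith
  show "(x t i k - xs i k)\<^sup>2 \<le> 2 * V t" if "i < n" "k < q i"
    using member_le_double_sum[where K = q and h = "\<lambda>i k. (x t i k - xs i k)\<^sup>2", OF that] g A
    unfolding V_def by simp
  show "(l t i r - \<mu> r)\<^sup>2 \<le> 2 * V t" if "i < n" "r < m"
    using member_le_double_sum[where K = "\<lambda>_. m" and h = "\<lambda>i r. (l t i r - \<mu> r)\<^sup>2", OF that] g A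
    unfolding V_def by simp
  show "(z t i r - zs i r)\<^sup>2 \<le> 2 * V t" if "i < n" "r < m"
    using member_le_double_sum[where K = "\<lambda>_. m" and h = "\<lambda>i r. (z t i r - zs i r)\<^sup>2", OF that] g A
    unfolding V_def by simp
qed

section \<open>Boundedness and convergence of trajectories\<close>

text \<open>Since \<open>V t \<le> V 0\<close>, every coordinate stays within
  \<open>sqrt (2 * V 0)\<close> of the corresponding one of \<open>xs\<close>, \<mu> or
  \<open>zs\<close>.\<close>

lemma solution_bounded:
  "\<exists>B. \<forall>t\<ge>0. \<forall>i<n. (\<forall>k<q i. \<bar>x t i k\<bar> \<le> B) \<and> (\<forall>r<m. \<bar>l t i r\<bar> \<le> B \<and> \<bar>z t i r\<bar> \<le> B)"
proof -
  define \<rho> where "\<rho> = sqrt (2 * V 0)"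
  define B where "B = \<rho> + (\<Sum>i<n. \<Sum>k<q i. \<bar>xs i k\<bar>) + (\<Sum>r<m. \<bar>\<mu> r\<bar>) + (\<Sum>i<n. \<Sum>r<m. \<bar>zs i r\<bar>)"
  have A: "0 \<le> (\<Sum>i<n. \<Sum>k<q i. \<bar>xs i k\<bar>)" "0 \<le> (\<Sum>r<m. \<bar>\<mu> r\<bar>)" "0 \<le> (\<Sum>i<n. \<Sum>r<m. \<bar>zs i r\<bar>)"
    by (intro sum_nonneg; simp)+
  have root: "\<bar>y\<bar> \<le> \<rho> + \<bar>c\<bar>" if "(y - c)\<^sup>2 \<le> 2 * V t" "0 \<le> t" for y c t
  proof -
    have "(y - c)\<^sup>2 \<le> 2 * V 0" using that V_antimono[of 0 t] by simp
    then have "\<bar>y - c\<bar> \<le> \<rho>" unfolding \<rho>_def by (metis real_sqrt_abs real_sqrt_le_iff)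
    then show ?thesis by linarith
  qed
  have "\<bar>x t i k\<bar> \<le> B" if "0 \<le> t" "i < n" "k < q i" for t i k
    using root[OF V_bounds(2)[OF that] that(1)] A
      member_le_double_sum[where K = q and h = "\<lambda>i k. \<bar>xs i k\<bar>", OF that(2,3)]
    unfolding B_def by linarith
  moreover have "\<bar>l t i r\<bar> \<le> B" if "0 \<le> t" "i < n" "r < m" for t i r
    using root[OF V_bounds(3)[OF that] that(1)] A member_le_sum[of r "{..<m}" "\<lambda>r. \<bar>\<mu> r\<bar>"] that(3)
    unfolding B_def by fastforce
  moreover have "\<bar>z t i r\<bar> \<le> B" if "0 \<le> t" "i < n" "r < m" for t i r
    using root[OF V_bounds(4)[OF that] that(1)] A
      member_le_double_sum[where K = "\<lambda>_. m" and h = "\<lambda>i k. \<bar>zs i k\<bar>", OF that(2,3)]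
    unfolding B_def by linarith
  ultimately show ?thesis by blast
qed

text \<open>For a sign \<sigma>, expanding \<open>0 \<le> (\<sigma> * p i k - 1/2)\<^sup>2\<close>
  bounds the rate of the signed coordinate by \<open>(p i k)\<^sup>2 + 1/4\<close>, and the square
  is paid for by the dissipation.\<close>

lemma x_increment_le:
  assumes st: "0 \<le> s" "s \<le> t" and ik: "i < n" "k < q i"
  shows "\<bar>x t i k - x s i k\<bar> \<le> V s - V t + (t - s) / 4"
proof -
  have "V t + (\<sigma> * x t i k - 1/4 * t) \<le> V s + (\<sigma> * x s i k - 1/4 * s)" if \<sigma>: "\<bar>\<sigma>\<bar> = 1" for \<sigma> :: real
  proof (rule V_dissipation[OF st, where R = "\<lambda>t. \<sigma> * x t i k - 1/4 * t"])
    show "abs_cont_on {s..t} (\<lambda>t. \<sigma> * x t i k - 1/4 * t)"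
      by (intro abs_cont_on_diff abs_cont_on_cmult abs_cont_on_ident x_ac ik st)
    fix \<tau> p u w assume \<tau>: "s < \<tau>" and v: "velocity \<tau> p u w"
    have "((\<lambda>s. x s i k) has_real_derivative p i k) (at \<tau>)"
      using v ik by (auto simp: velocity_def)
    then have "((\<lambda>t. \<sigma> * x t i k - 1/4 * t) has_real_derivative \<sigma> * p i k - 1/4 * 1) (at \<tau>)"
      by (intro DERIV_diff DERIV_cmult DERIV_ident)
    moreover have "\<sigma> * p i k - 1/4 * 1 \<le> (p i k)\<^sup>2"
    proof -
      have "0 \<le> (\<sigma> * p i k - 1/2)\<^sup>2" by simp
      also have "\<dots> = \<sigma>\<^sup>2 * (p i k)\<^sup>2 - \<sigma> * p i k + 1/4" by (simp add: power2_eq_square algebra_simps)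
      also have "\<sigma>\<^sup>2 = 1" using power2_abs[of \<sigma>] \<sigma> by simp
      finally show ?thesis by simp
    qed
    moreover have "(p i k)\<^sup>2 \<le> (\<Sum>i<n. \<Sum>k<q i. (p i k)\<^sup>2)"
      using ik by (intro member_le_double_sum) auto
    moreover have "0 \<le> gap (x \<tau>)" using \<tau> st by (intro gap_nonneg x_Xset) auto
    ultimately show "\<exists>\<rho>. ((\<lambda>t. \<sigma> * x t i k - 1/4 * t) has_real_derivative \<rho>) (at \<tau>) \<and>
        \<rho> \<le> (\<Sum>i<n. \<Sum>k<q i. (p i k)\<^sup>2) + gap (x \<tau>)"
      by (intro exI[of _ "\<sigma> * p i k - 1/4 * 1"]) auto
  qed
  from this[of 1, simplified] this[of "-1", simplified] show ?thesis
    unfolding diff_divide_distrib by linarith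
qed

text \<open>Late in time \<open>V\<close> is close to its infimum. A point at distance \<epsilon>
  from the optimum would keep the gap above some \<open>c\<close> for a duration \<epsilon>, pushing
  \<open>V\<close> below that infimum.\<close>

lemma x_tendsto:
  assumes ik: "i < n" "k < q i"
  shows "((\<lambda>t. x t i k) \<longlongrightarrow> xs i k) at_top"
proof (rule tendstoI)
  fix \<epsilon> :: real assume \<epsilon>: "\<epsilon> > 0"
  obtain B where B: "\<forall>t\<ge>0. \<forall>i<n. (\<forall>k<q i. \<bar>x t i k\<bar> \<le> B) \<and> (\<forall>r<m. \<bar>l t i r\<bar> \<le> B \<and> \<bar>z t i r\<bar> \<le> B)"
    using solution_bounded by blast
  obtain c where c: "c > 0" "\<forall>y\<in>Xset n Om. (\<forall>i<n. \<forall>k<q i. \<bar>y i k\<bar> \<le> B) \<longrightarrow>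
      \<epsilon> / 2 \<le> \<bar>y i k - xs i k\<bar> \<longrightarrow> c \<le> gap y"
    using gap_bounded_below[of "\<epsilon> / 2" i k B] \<epsilon> ik by auto
  define V0 where "V0 = Inf (V ` {0..})"
  have bdd: "bdd_below (V ` {0..})" using V_bounds(1) by (intro bdd_belowI[of _ 0]) auto
  have V0: "V0 \<le> V t" if "0 \<le> t" for t
    unfolding V0_def using that bdd by (intro cInf_lower) auto
  \<comment> \<open>The bound \<open>\<epsilon> / 4\<close> limits the movement of \<open>x\<close>
    after time \<open>T\<close>; the bound \<open>c * \<epsilon>\<close> is the loss of
    \<open>V\<close> during one stay away from the optimum.\<close>
  have "V0 < V0 + min (\<epsilon> / 4) (c * \<epsilon>)" using \<epsilon> c by simp
  then obtain T where T: "0 \<le> T" "V T < V0 + min (\<epsilon> / 4) (c * \<epsilon>)"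
    using cInf_lessD[of "V ` {0..}" "V0 + min (\<epsilon> / 4) (c * \<epsilon>)"] unfolding V0_def by auto
  have "dist (x t i k) (xs i k) < \<epsilon>" if t: "T \<le> t" for t
  proof (rule ccontr)
    assume "\<not> ?thesis"
    then have far: "\<epsilon> \<le> \<bar>x t i k - xs i k\<bar>" by (simp add: dist_real_def)
    have t0: "0 \<le> t" using T t by simp
    have Vt: "V t < V0 + \<epsilon> / 4" "V t < V0 + c * \<epsilon>" using V_antimono[OF T(1) t] T(2) by auto
    \<comment> \<open>During time \<epsilon> the coordinate moves by at most
      \<open>\<epsilon> / 2\<close>, one half of this from the decrease of \<open>V\<close> and one
      from elapsed time, so it remains \<open>\<epsilon> / 2\<close> away.\<close>
    have "c \<le> gap (x s)" if s: "t \<le> s" "s \<le> t + \<epsilon>" for s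
    proof -
      have "\<bar>x s i k - x t i k\<bar> \<le> V t - V s + (s - t) / 4" by (rule x_increment_le[OF t0 s(1) ik])
      also have "\<dots> \<le> \<epsilon> / 4 + \<epsilon> / 4" using Vt(1) V0[of s] s t0 by (intro add_mono) auto
      finally have "\<epsilon> / 2 \<le> \<bar>x s i k - xs i k\<bar>" using far by linarith
      then show ?thesis using c(2) x_Xset[of s] B s t0 by auto
    qed
    note gap_c = this
    have "V (t + \<epsilon>) + c * (t + \<epsilon>) \<le> V t + c * t"
    proof (rule V_dissipation[where R = "\<lambda>\<tau>. c * \<tau>"])
      fix \<tau> and p u w :: "nat \<Rightarrow> nat \<Rightarrow> real" assume \<tau>: "t < \<tau>" "\<tau> < t + \<epsilon>"
      have "0 \<le> (\<Sum>i<n. \<Sum>k<q i. (p i k)\<^sup>2)" by (intro sum_nonneg) auto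
      moreover have "c \<le> gap (x \<tau>)" using \<tau> by (intro gap_c) auto
      moreover have "((\<lambda>\<tau>. c * \<tau>) has_real_derivative c * 1) (at \<tau>)" by (intro DERIV_cmult DERIV_ident)
      ultimately show "\<exists>\<rho>. ((\<lambda>\<tau>. c * \<tau>) has_real_derivative \<rho>) (at \<tau>) \<and>
          \<rho> \<le> (\<Sum>i<n. \<Sum>k<q i. (p i k)\<^sup>2) + gap (x \<tau>)"
        by (intro exI[of _ "c * 1"]) auto
    qed (use t0 \<epsilon> in \<open>auto intro!: abs_cont_on_cmult abs_cont_on_ident\<close>)
    then have "V (t + \<epsilon>) \<le> V t - c * \<epsilon>" by (simp add: algebra_simps)
    then show False using Vt(2) V0[of "t + \<epsilon>"] t0 \<epsilon> by auto
  qed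
  then show "\<forall>\<^sub>F t in at_top. dist (x t i k) (xs i k) < \<epsilon>"
    unfolding eventually_at_top_linorder by blast
qed

end

section \<open>Construction of the saddle point and conclusion\<close>

theorem theorem4:
  fixes n m :: nat and q :: "nat \<Rightarrow> nat" and a :: "nat \<Rightarrow> nat \<Rightarrow> real"
    and Om U :: "nat \<Rightarrow> (nat \<Rightarrow> real) set" and f :: "nat \<Rightarrow> (nat \<Rightarrow> real) \<Rightarrow> real"
    and W :: "nat \<Rightarrow> nat \<Rightarrow> nat \<Rightarrow> real" and d :: "nat \<Rightarrow> nat \<Rightarrow> real"
  assumes n_pos: "n \<ge> 1"
    and graph: "weighted_graph n a" and conn: "graph_connected n a"
    and Om_closed: "\<forall>i<n. closed_Rn (q i) (Om i)"
    and Om_convex: "\<forall>i<n. cvx_set (Om i)"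
    and U_open: "\<forall>i<n. open_Rn (q i) (U i) \<and> Om i \<subseteq> U i"
    and f_strict: "\<forall>i<n. strict_cvx_on (q i) (U i) (f i)"
    and d_dim: "\<forall>i<n. d i \<in> Rn m"
    and slater: "\<exists>x. (\<forall>i<n. x i \<in> interior_Rn (q i) (Om i)) \<and> (\<forall>i\<ge>n. x i = (\<lambda>_. 0)) \<and>
                   (\<forall>r<m. (\<Sum>i<n. Wmul m (q i) (W i) (x i) r) = (\<Sum>i<n. d i r))"
    and opt_exists: "\<exists>xs. is_optimal n m q Om f W d xs"
    and F_convex: "\<forall>x\<in>Xset n Om. \<forall>l\<in>Lspace n m. \<forall>z\<in>Lspace n m.
                     cvx_set3 (Fmap n m q a Om U f W d x l z)"
  shows
    "\<forall>x l z. is_solution n m q a Om U f W d x l z \<and> x 0 \<in> Xset n Om \<longrightarrow>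
       (\<exists>B. \<forall>t\<ge>0. \<forall>i<n. (\<forall>k<q i. \<bar>x t i k\<bar> \<le> B) \<and> (\<forall>r<m. \<bar>l t i r\<bar> \<le> B \<and> \<bar>z t i r\<bar> \<le> B)) \<and>
       (\<forall>xs. is_optimal n m q Om f W d xs \<longrightarrow>
          (\<forall>i<n. \<forall>k<q i. ((\<lambda>t. x t i k) \<longlongrightarrow> xs i k) at_top))"
proof (intro allI impI, elim conjE)
  fix x l z assume sol: "is_solution n m q a Om U f W d x l z" "x 0 \<in> Xset n Om"
  \<comment> \<open>The saddle point is built around an arbitrary optimal \<open>xs\<close>.
    Boundedness then uses one that exists by assumption, and convergence uses the given one.\<close>
  have traj: "\<exists>\<mu> zs. trajectory n m q a Om U f W d xs \<mu> zs x l z"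
    if opt: "is_optimal n m q Om f W d xs" for xs
  proof -
    have feas: "feasible n m q Om W d xs" using opt by (simp add: is_optimal_def)
    have Om_sub: "\<forall>i<n. Om i \<subseteq> Rn (q i)" "\<forall>i<n. Om i \<subseteq> U i"
      using Om_closed U_open by (auto simp: closed_Rn_def)
    obtain x0 where x0: "\<forall>i<n. x0 i \<in> interior_Rn (q i) (Om i)" "\<forall>i\<ge>n. x0 i = (\<lambda>_. 0)"
      "\<forall>r<m. (\<Sum>i<n. Wmul m (q i) (W i) (x0 i) r) = (\<Sum>i<n. d i r)"
      using slater by blast
    obtain \<mu> where \<mu>: "\<forall>y\<in>Xset n Om. (\<Sum>r<m. \<mu> r * ((\<Sum>i<n. Wmul m (q i) (W i) (y i) r) - (\<Sum>i<n. d i r)))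
        \<le> (\<Sum>i<n. f i (y i)) - (\<Sum>i<n. f i (xs i))"
      using Lagrange_multiplier_exists[OF Om_convex Om_sub f_strict x0 opt] by blast
    \<comment> \<open>The Laplacian acts on each of the \<open>m\<close> coordinates separately;
      solvability holds because the local residuals add up to zero at a feasible point.\<close>
    have "\<exists>v. \<forall>i<n. (\<Sum>j<n. a i j * (v i - v j)) = d i r - Wmul m (q i) (W i) (xs i) r" if "r < m" for r
      using feas that by (intro laplacian_solvable graph conn) (simp add: sum_subtractf feasible_def)
    then obtain Z where Z: "\<And>r i. r < m \<Longrightarrow> i < n \<Longrightarrow>
        (\<Sum>j<n. a i j * (Z r i - Z r j)) = d i r - Wmul m (q i) (W i) (xs i) r"
      by metis
    have "trajectory n m q a Om U f W d xs \<mu> (\<lambda>i r. Z r i) x l z"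
      by unfold_locales (use graph Om_closed Om_convex U_open f_strict feas \<mu> Z sol in \<open>auto simp: lap_def\<close>)
    then show ?thesis by blast
  qed
  show "(\<exists>B. \<forall>t\<ge>0. \<forall>i<n. (\<forall>k<q i. \<bar>x t i k\<bar> \<le> B) \<and> (\<forall>r<m. \<bar>l t i r\<bar> \<le> B \<and> \<bar>z t i r\<bar> \<le> B)) \<and>
       (\<forall>xs. is_optimal n m q Om f W d xs \<longrightarrow>
          (\<forall>i<n. \<forall>k<q i. ((\<lambda>t. x t i k) \<longlongrightarrow> xs i k) at_top))"
  proof (intro conjI allI impI)
    show "\<exists>B. \<forall>t\<ge>0. \<forall>i<n. (\<forall>k<q i. \<bar>x t i k\<bar> \<le> B) \<and> (\<forall>r<m. \<bar>l t i r\<bar> \<le> B \<and> \<bar>z t i r\<bar> \<le> B)"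
      using opt_exists traj trajectory.solution_bounded by blast
    show "((\<lambda>t. x t i k) \<longlongrightarrow> xs i k) at_top"
      if "is_optimal n m q Om f W d xs" "i < n" "k < q i" for xs i k
      using traj[OF that(1)] trajectory.x_tendsto that(2,3) by blast
  qed
qed

end
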